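(* Let $p=p(n)\in(0,1)$ satisfy $p\gg n^{-2}$, let $G_{n,p}$ be the Erdős–Rényi random graph on node set $[n]$, and let $K_{n,p}=f_1(C_{n,p})$ be the number of edges of the random cosmological polytope $C_{n,p}=C_{G_{n,p}}$. Then, as $n\to\infty$, (1) $\mathbb{E}[K_{n,p}]\simeq n^4p^2$ and $\mathbb{V}(K_{n,p})\simeq n^6p^3(1-p)$; (2) $\displaystyle d_K\!\left(\frac{K_{n,p}-\mathbb{E}[K_{n,p}]}{\sqrt{\mathbb{V}(K_{n,p})}},N\right)\lesssim \frac{1}{n\sqrt{p(1-p)}}$, where $N\sim\mathcal N(0,1)$ is a standard Gaussian random variable.
   Context: For a finite simple graph $G=(V,E)$ (elements of $V$ are called nodes, elements of $E$ arcs), let $(\mathbf e_a)_{a\in V\cup E}$ be the standard basis of $\mathbb R^{V\cup E}$. The cosmological polytope of $G$ is $C_G=\operatorname{conv}\{\mathbf e_i+\mathbf e_j-\mathbf e_f,\ \mathbf e_i-\mathbf e_j+\mathbf e_f,\ -\mathbf e_i+\mathbf e_j+\mathbf e_f : f=\{i,j\}\in E\}\subset\mathbb R^{V\cup E}$; $f_1$ denotes the number of (one-dimensional) edges of a polytope. $G_{n,p}$ is the random graph on $[n]=\{1,\dots,n\}$ in which each of the $\binom n2$ possible arcs is present independently with probability $p$. For sequences, $a_n\lesssim b_n$ means $\limsup|a_n/b_n|<\infty$; $a_n\simeq b_n$ means $0<\liminf|a_n/b_n|\le\limsup|a_n/b_n|<\infty$; $a_n\gg b_n$ means $|a_n/b_n|\to\infty$.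 The Kolmogorov distance is $d_K(Y,Z)=\sup_{z\in\mathbb R}|\mathbb P(Y\le z)-\mathbb P(Z\le z)|$. *)

theory Defs
  imports
    "HOL-Probability.Probability"
    "HOL-Analysis.Finite_Function_Topology"
begin

type_synonym 'v graph = "'v set \<times> 'v set set"

definition finite_simple_graph :: "'v graph \<Rightarrow> bool" where
  "finite_simple_graph G \<longleftrightarrow> finite (fst G) \<and> snd G \<subseteq> {f. f \<subseteq> fst G \<and> card f = 2}"

text \<open>
  The spaces indexed by the union of V and E, for all graphs with nodes in \<^typ>\<open>'v\<close>, are taken
  as coordinate subspaces of one real vector space, the finitely supported functions on
  \<^typ>\<open>'v + 'v set\<close>, with \<^term>\<open>Inl i\<close> the coordinate of a node and \<^term>\<open>Inr f\<close> that of an arc.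
  Faces and their dimensions do not depend on the ambient space.
\<close>

definition node_vec :: "'v \<Rightarrow> ('v + 'v set, real) poly_mapping" where
  "node_vec i = Poly_Mapping.single (Inl i) 1"

definition arc_vec :: "'v set \<Rightarrow> ('v + 'v set, real) poly_mapping" where
  "arc_vec f = Poly_Mapping.single (Inr f) 1"

definition cosmological_polytope :: "'v graph \<Rightarrow> ('v + 'v set, real) poly_mapping set" where
  "cosmological_polytope G = convex hull
     (\<Union>{ { node_vec i + node_vec j - arc_vec {i, j},
           node_vec i - node_vec j + arc_vec {i, j},
           - node_vec i + node_vec j + arc_vec {i, j} } | i j. {i, j} \<in> snd G })"

lemma cosmological_polytope_subset_coordinate_space:
  assumes "finite_simple_graph G"
  shows "cosmological_polytope G \<subseteq> {x. Poly_Mapping.keys x \<subseteq> Inl ` fst G \<union> Inr ` snd G}"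
proof -
  define A where "A = Inl ` fst G \<union> Inr ` snd G"
  define S where "S = {x :: (_ + _ set, real) poly_mapping.
      \<forall>a. a \<notin> A \<longrightarrow> Poly_Mapping.lookup x a = 0}"
  have eq: "{x. Poly_Mapping.keys x \<subseteq> A} = S"
    unfolding S_def by (auto simp: subset_iff in_keys_iff)
  have lookup_scale: "Poly_Mapping.lookup (r *\<^sub>R x) a = r * Poly_Mapping.lookup x a"
    for r and x :: "(_ + _ set, real) poly_mapping" and a
  proof -
    have "finite {i. r *\<^sub>R Poly_Mapping.lookup x i \<noteq> 0}"
      by (rule finite_subset[OF _ finite_lookup[of x]]) auto
    then show ?thesis
      by (simp add: scaleR_poly_mapping_def Abs_poly_mapping_inverse)
  qed
  have "convex S"
    unfolding convex_def S_def by (simp add: lookup_add lookup_scale)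
  moreover have gen: "{node_vec i + node_vec j - arc_vec {i, j},
           node_vec i - node_vec j + arc_vec {i, j},
           - node_vec i + node_vec j + arc_vec {i, j}} \<subseteq> S" if f: "{i, j} \<in> snd G" for i j
  proof -
    have "Inl i \<in> A" "Inl j \<in> A" "Inr {i, j} \<in> A"
      using f assms by (auto simp: finite_simple_graph_def A_def)
    then have "Poly_Mapping.lookup (node_vec i) a = 0 \<and> Poly_Mapping.lookup (node_vec j) a = 0
        \<and> Poly_Mapping.lookup (arc_vec {i, j}) a = 0" if "a \<notin> A" for a
      using that by (metis node_vec_def arc_vec_def lookup_single_not_eq)
    then show ?thesis
      by (simp add: S_def lookup_add lookup_minus)
  qed
  ultimately show ?thesis
    unfolding cosmological_polytope_def A_def[symmetric] eq
    by (intro hull_minimal Union_least) (elim CollectE exE conjE, simp only: gen)+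
qed

text \<open>
  The library's \<^const>\<open>aff_dim\<close> and \<^const>\<open>edge_of\<close> are restricted to \<^class>\<open>euclidean_space\<close>, so that
  the dimension of a nonempty set is restated for \<^class>\<open>real_vector\<close> as that of the linear space
  parallel to its affine hull.
\<close>

definition affine_dimension :: "'a::real_vector set \<Rightarrow> int" where
  "affine_dimension S = (if S = {} then -1 else int (dim {x - y | x y. x \<in> S \<and> y \<in> S}))"

lemma affine_dimension_eq_aff_dim:
  fixes S :: "'a::euclidean_space set"
  shows "affine_dimension S = aff_dim S"
proof (cases "S = {}")
  case False
  then obtain a where a: "a \<in> S" by blast
  let ?D = "{x - y | x y. x \<in> S \<and> y \<in> S}" and ?T = "(\<lambda>x. x - a) ` S"
  have "x - y \<in> span ?T" if "x \<in> S" "y \<in> S" for x y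
  proof -
    have "(x - a) - (y - a) \<in> span ?T"
      using that by (intro span_diff span_base imageI)
    then show ?thesis by simp
  qed
  then have "?D \<subseteq> span ?T" by blast
  moreover have "?T \<subseteq> span ?D"
    by (rule order_trans[OF _ span_superset]) (use a in blast)
  ultimately have "dim ?D = dim ?T"
    by (intro span_eq_dim) (simp only: span_eq)
  then show ?thesis
    using False aff_dim_eq_dim_subtract[OF hull_inc[OF a]] by (simp add: affine_dimension_def)
qed (simp add: affine_dimension_def)

definition face_number :: "nat \<Rightarrow> 'a::real_vector set \<Rightarrow> nat" where
  "face_number k P = card {F. F face_of P \<and> affine_dimension F = int k}"

lemma face_number_1_eq_card_edges:
  fixes P :: "'a::euclidean_space set"
  shows "face_number 1 P = card {e. e edge_of P}"
  by (simp add: face_number_def edge_of_def affine_dimension_eq_aff_dim)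

definition possible_arcs :: "nat \<Rightarrow> nat set set" where
  "possible_arcs n = {f. f \<subseteq> {1..n} \<and> card f = 2}"

definition erdos_renyi :: "nat \<Rightarrow> real \<Rightarrow> nat graph pmf" where
  "erdos_renyi n p =
     map_pmf (\<lambda>X. ({1..n}, {f \<in> possible_arcs n. X f}))
       (Pi_pmf (possible_arcs n) False (\<lambda>_. bernoulli_pmf p))"

lemma finite_simple_graph_erdos_renyi:
  "G \<in> set_pmf (erdos_renyi n p) \<Longrightarrow> finite_simple_graph G"
  unfolding erdos_renyi_def set_map_pmf
  by (elim imageE) (simp add: finite_simple_graph_def possible_arcs_def, blast)

definition polytope_edges :: "nat graph \<Rightarrow> real" where
  "polytope_edges G = real (face_number 1 (cosmological_polytope G))"

definition mean_edges :: "nat \<Rightarrow> real \<Rightarrow> real" where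
  "mean_edges n p = measure_pmf.expectation (erdos_renyi n p) polytope_edges"

definition variance_edges :: "nat \<Rightarrow> real \<Rightarrow> real" where
  "variance_edges n p = measure_pmf.variance (erdos_renyi n p) polytope_edges"

definition standardized_edges_law :: "nat \<Rightarrow> real \<Rightarrow> real measure" where
  "standardized_edges_law n p =
     distr (measure_pmf (erdos_renyi n p)) borel
       (\<lambda>G. (polytope_edges G - mean_edges n p) / sqrt (variance_edges n p))"

text \<open>The Kolmogorov distance of two random variables, in terms of their laws.\<close>

definition kolmogorov_dist :: "real measure \<Rightarrow> real measure \<Rightarrow> real" where
  "kolmogorov_dist M N = (SUP z. \<bar>cdf M z - cdf N z\<bar>)"

definition asymp_lesssim :: "(nat \<Rightarrow> real) \<Rightarrow> (nat \<Rightarrow> real) \<Rightarrow> bool" where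
  "asymp_lesssim a b \<longleftrightarrow> limsup (\<lambda>n. ereal \<bar>a n / b n\<bar>) < \<infinity>"

definition asymp_simeq :: "(nat \<Rightarrow> real) \<Rightarrow> (nat \<Rightarrow> real) \<Rightarrow> bool" where
  "asymp_simeq a b \<longleftrightarrow>
     0 < liminf (\<lambda>n. ereal \<bar>a n / b n\<bar>) \<and>
     liminf (\<lambda>n. ereal \<bar>a n / b n\<bar>) \<le> limsup (\<lambda>n. ereal \<bar>a n / b n\<bar>) \<and>
     limsup (\<lambda>n. ereal \<bar>a n / b n\<bar>) < \<infinity>"

definition asymp_gg :: "(nat \<Rightarrow> real) \<Rightarrow> (nat \<Rightarrow> real) \<Rightarrow> bool" where
  "asymp_gg a b \<longleftrightarrow> filterlim (\<lambda>n. \<bar>a n / b n\<bar>) at_top sequentially"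

end

theory Submission
  imports Defs "HOL-Real_Asymp.Real_Asymp"
begin

text \<open>
  The polytope of a graph with \<open>m\<close> arcs has \<open>3m\<close> vertices, three per arc. Two vertices of different
  arcs always span an edge. Of the three pairs belonging to one arc \<open>f = {i, j}\<close>, the pair with
  midpoint \<open>e\<^sub>f\<close> spans an edge, and the pair with midpoint \<open>e\<^sub>i\<close> does so iff \<open>f\<close> is the only arc at
  \<open>i\<close>, because every arc at \<open>i\<close> contributes such a pair. Hence the number of edges is
  \<open>K = 9/2 m\<^sup>2 - 3/2 m - B\<close>, where \<open>B\<close> is the sum of all degrees that are at least 2, so that
  \<open>0 \<le> B \<le> 2m\<close>.

  With \<open>N = n choose 2\<close>, the number \<open>m\<close> is binomial with mean \<open>\<mu> = Np\<close> and variance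
  \<open>\<sigma>\<^sup>2 = Np(1 - p)\<close>. The linear part \<open>9\<mu>m\<close> of \<open>K\<close> has standard deviation \<open>9\<mu>\<sigma>\<close>; by the Efron-Stein
  inequality the remainder has standard deviation \<open>O(\<sigma> sqrt \<mu>)\<close>. For the Kolmogorov distance, the
  bounds on \<open>B\<close> sandwich the event \<open>K \<le> t\<close> between two events \<open>m \<le> \<mu> + \<sigma>y\<close>, with
  \<open>y = z + O((1 + z\<^sup>2)/\<sigma>)\<close> where \<open>z\<close> is the standardized \<open>t\<close>, and the Berry-Esseen bound \<open>O(1/\<sigma>)\<close>
  for \<open>m\<close>, proved by Stein's method, applies. For \<open>\<bar>z\<bar> \<ge> sqrt \<sigma>\<close>, Chebyshev's inequality suffices.
\<close>

section \<open>Edges of the cosmological polytope\<close>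

lemma lookup_scaleR_poly_mapping:
  "Poly_Mapping.lookup (r *\<^sub>R x) a = r *\<^sub>R Poly_Mapping.lookup x a"
proof -
  have "finite {i. r *\<^sub>R Poly_Mapping.lookup x i \<noteq> 0}"
    by (rule finite_subset[OF _ finite_lookup[of x]]) auto
  then show ?thesis
    by (simp add: scaleR_poly_mapping_def Abs_poly_mapping_inverse)
qed

text \<open>The affine hull of \<open>T\<close> stays in the hyperplane \<open>l x = M\<close> and
  the hull of the remaining points in the open half-space below it; that these two hulls are
  disjoint is a sufficient criterion for a face.\<close>

lemma face_of_convex_hull_exposed:
  fixes l :: "'a::real_vector \<Rightarrow> real"
  assumes "finite S" "T \<subseteq> S" and lin: "linear l"
    and eq: "\<And>x. x \<in> T \<Longrightarrow> l x = M" and less: "\<And>x. x \<in> S - T \<Longrightarrow> l x < M"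
  shows "convex hull T face_of convex hull S"
proof (rule face_of_convex_hulls[OF assms(1,2)])
  have "affine {x. l x = M}"
    unfolding affine_def
    by (auto simp: linear_add[OF lin] linear_scale[OF lin] simp flip: distrib_right)
  then have "affine hull T \<subseteq> {x. l x = M}"
    using eq by (intro hull_minimal) auto
  moreover have "convex {x. l x < M}"
    using convex_linear_vimage[OF lin, of "{..<M}"] by (simp add: vimage_def)
  then have "convex hull (S - T) \<subseteq> {x. l x < M}"
    using less by (intro hull_minimal) auto
  ultimately show "affine hull T \<inter> convex hull (S - T) = {}"
    by fastforce
qed

text \<open>If \<open>v\<close> has positive weight in a convex combination equal to
  \<open>x\<close> in \<open>F\<close>, then \<open>x\<close> is \<open>v\<close> or lies strictly
  between \<open>v\<close> and the barycentre \<open>y\<close> of the rest (or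
  \<open>v = y = x\<close>), so the face contains \<open>v\<close>. Hence only points of
  \<open>F \<inter> S\<close> occur in the combination.\<close>

lemma face_of_convex_hull_finite:
  fixes S :: "'a::real_vector set"
  assumes S: "finite S" and F: "F face_of convex hull S"
  shows "F = convex hull (F \<inter> S)"
proof
  show "convex hull (F \<inter> S) \<subseteq> F"
    using face_of_imp_convex[OF F] by (intro hull_minimal) auto
  show "F \<subseteq> convex hull (F \<inter> S)"
  proof
    fix x assume x: "x \<in> F"
    then have "x \<in> convex hull S" using face_of_imp_subset[OF F] by blast
    then obtain u where u: "\<And>v. v \<in> S \<Longrightarrow> 0 \<le> u v" "sum u S = 1" "(\<Sum>v\<in>S. u v *\<^sub>R v) = x"
      by (auto simp: convex_hull_finite[OF S])
    have mem: "v \<in> F" if v: "v \<in> S" "u v \<noteq> 0" for v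
    proof -
      let ?R = "S - {v}"
      define s where "s = sum u ?R"
      have s: "u v + s = 1" "0 \<le> s"
        using u(1,2) sum.remove[OF S v(1), of u] by (auto simp: s_def intro!: sum_nonneg)
      have xs: "x = u v *\<^sub>R v + (\<Sum>w\<in>?R. u w *\<^sub>R w)"
        using u(3) sum.remove[OF S v(1), of "\<lambda>w. u w *\<^sub>R w"] by simp
      show ?thesis
      proof (cases "s = 0")
        case True
        then have "\<forall>w\<in>?R. u w = 0"
          using u(1) S by (subst (asm) s_def, subst (asm) sum_nonneg_eq_0_iff) auto
        then have "x = v" using xs s True by simp
        then show ?thesis using x by simp
      next
        case False
        define y where "y = (\<Sum>w\<in>?R. (u w / s) *\<^sub>R w)"
        have "y \<in> convex hull S"
          unfolding y_def
        proof (rule convex_sum)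
          show "sum (\<lambda>w. u w / s) ?R = 1"
            using False by (simp add: s_def flip: sum_divide_distrib)
        qed (use S u s in \<open>auto intro: hull_inc\<close>)
        moreover have xy: "x = (1 - s) *\<^sub>R v + s *\<^sub>R y"
        proof -
          have "u v = 1 - s" using s by simp
          then show ?thesis unfolding xs y_def using False by (simp add: scaleR_sum_right)
        qed
        moreover have "v \<in> convex hull S" using v by (simp add: hull_inc)
        moreover have "0 < s" "s < 1" using s False u(1)[OF v(1)] v(2) by auto
        ultimately show ?thesis
          using face_ofD[OF F, of x v y] x
          by (cases "v = y") (auto simp: in_segment algebra_simps)
      qed
    qed
    have "x = (\<Sum>v\<in>F \<inter> S. u v *\<^sub>R v)"
      unfolding u(3)[symmetric] using mem S by (intro sum.mono_neutral_right) auto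
    moreover have "sum u (F \<inter> S) = 1"
      unfolding u(2)[symmetric] using mem S by (intro sum.mono_neutral_left) auto
    moreover have "(\<Sum>v\<in>F \<inter> S. u v *\<^sub>R v) \<in> convex hull (F \<inter> S)"
      by (rule convex_sum) (use calculation(2) S u(1) in \<open>auto intro: hull_inc\<close>)
    ultimately show "x \<in> convex hull (F \<inter> S)" by simp
  qed
qed

lemma affine_dimension_segment:
  fixes u v :: "'a::real_vector"
  assumes "u \<noteq> v"
  shows "affine_dimension (convex hull {u, v}) = 1"
proof -
  let ?D = "{x - y | x y. x \<in> convex hull {u, v} \<and> y \<in> convex hull {u, v}}"
  have "x - y \<in> span {u - v}" if xy: "x \<in> convex hull {u, v}" "y \<in> convex hull {u, v}" for x y
  proof -
    obtain s t where st: "x = (1 - s) *\<^sub>R u + s *\<^sub>R v" "y = (1 - t) *\<^sub>R u + t *\<^sub>R v"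
      using xy by (auto simp: in_segment simp flip: segment_convex_hull)
    then have "x - y = (t - s) *\<^sub>R (u - v)"
      unfolding st by (simp add: algebra_simps)
    then show ?thesis by (simp add: span_base span_scale)
  qed
  then have "?D \<subseteq> span {u - v}" by blast
  moreover have "{u - v} \<subseteq> ?D" by (auto intro: hull_inc)
  moreover have "independent {u - v}" using assms by simp
  ultimately have "card {u - v} = dim ?D" by (intro basis_card_eq_dim)
  then show ?thesis by (simp add: affine_dimension_def)
qed

text \<open>Taking hulls is a bijection from pairs to faces, with inverse
  \<open>\<lambda>F. F \<inter> S\<close>. A face is the hull of the points of \<open>S\<close> in
  it; if it lies on a line it cannot contain three of them, since the middle one would not be
  extreme.\<close>

lemma face_number_1_convex_hull:
  fixes S :: "'a::real_vector set"
  assumes S: "finite S" and ext: "\<And>v. v \<in> S \<Longrightarrow> {v} face_of convex hull S"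
  shows "face_number 1 (convex hull S) = card {T. T \<subseteq> S \<and> card T = 2 \<and> convex hull T face_of convex hull S}"
proof -
  let ?P = "convex hull S"
  let ?A = "{T. T \<subseteq> S \<and> card T = 2 \<and> convex hull T face_of ?P}"
  let ?B = "{F. F face_of ?P \<and> affine_dimension F = int 1}"
  \<comment> \<open>A point of \<open>S\<close> in the smaller hull is still extreme there, and the
    extreme points of a hull are among its generators.\<close>
  have trace: "convex hull T \<inter> S = T" if T: "T \<subseteq> S" for T
  proof -
    have "v \<in> T" if v: "v \<in> convex hull T" "v \<in> S" for v
    proof -
      have "{v} face_of convex hull T"
        using v(1) hull_mono[OF T, of convex] by (intro face_of_subset[OF ext[OF v(2)]]) auto
      then show ?thesis
        using extreme_point_of_convex_hull by (auto simp: face_of_singleton)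
    qed
    then show ?thesis using T by (auto intro: hull_inc)
  qed
  have "bij_betw (\<lambda>T. convex hull T) ?A ?B"
    unfolding bij_betw_def
  proof
    show "inj_on (\<lambda>T. convex hull T) ?A"
      by (rule inj_on_inverseI[where g = "\<lambda>F. F \<inter> S"]) (simp add: trace)
    show "(\<lambda>T. convex hull T) ` ?A = ?B"
    proof
      show "(\<lambda>T. convex hull T) ` ?A \<subseteq> ?B"
        by (auto simp: card_2_iff affine_dimension_segment)
      show "?B \<subseteq> (\<lambda>T. convex hull T) ` ?A"
      proof
        fix F assume "F \<in> ?B"
        then have F: "F face_of ?P" and aff: "affine_dimension F = 1" by auto
        define D where "D = {x - y | x y. x \<in> F \<and> y \<in> F}"
        from aff have "F \<noteq> {}" and dim: "dim D = 1"
          by (auto simp: affine_dimension_def D_def split: if_splits)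
        obtain b where b: "D \<subseteq> span b" "independent b" "card b = dim D"
          using basis_exists by blast
        then obtain d where d: "b = {d}" using dim card_1_singletonE by metis
        have gen: "F = convex hull (F \<inter> S)"
          by (rule face_of_convex_hull_finite[OF S F])
        then obtain u where u: "u \<in> F" "u \<in> S" using \<open>F \<noteq> {}\<close>
          by (metis Int_iff convex_hull_empty ex_in_conv)
        have line: "\<exists>t. x = u + t *\<^sub>R d" if "x \<in> F" for x
        proof -
          have "x - u \<in> span {d}" using b(1) d that u by (auto simp: D_def)
          then obtain t where "x - u = t *\<^sub>R d" by (auto simp: span_singleton)
          then have "x = u + t *\<^sub>R d" by (simp add: algebra_simps)
          then show ?thesis by blast
        qed
        have no3: False if "r < s" "s < t" "u + r *\<^sub>R d \<in> F \<inter> S" "u + s *\<^sub>R d \<in> F \<inter> S" "u + t *\<^sub>R d \<in> F \<inter> S"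
          for r s t :: real
        proof -
          have "d \<noteq> 0" using b(2) d dependent_zero by auto
          define c where "c = (s - r) / (t - r)"
          have c: "0 < c" "c < 1" "s = r + c * (t - r)" using that by (auto simp: c_def field_simps)
          have "u + s *\<^sub>R d = (1 - c) *\<^sub>R (u + r *\<^sub>R d) + c *\<^sub>R (u + t *\<^sub>R d)"
            by (simp add: c(3) algebra_simps)
          then have "u + s *\<^sub>R d \<in> open_segment (u + r *\<^sub>R d) (u + t *\<^sub>R d)"
            using that \<open>d \<noteq> 0\<close> c by (auto simp: in_segment)
          moreover have "{u + s *\<^sub>R d} face_of ?P" using ext that by blast
          moreover have "u + r *\<^sub>R d \<in> ?P" "u + t *\<^sub>R d \<in> ?P" using that by (auto intro: hull_inc)
          ultimately have "u + r *\<^sub>R d \<in> {u + s *\<^sub>R d}"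
            using face_ofD by blast
          then show False using \<open>d \<noteq> 0\<close> that by simp
        qed
        have "\<exists>v\<in>F \<inter> S. v \<noteq> u"
        proof (rule ccontr)
          assume "\<not> (\<exists>v\<in>F \<inter> S. v \<noteq> u)"
          then have "F \<inter> S = {u}" using u by blast
          then have "F = {u}" using gen by simp
          then have "D = {0}" by (auto simp: D_def)
          then show False using dim dim_le_card[of "{0 :: 'a}" "{}"] by simp
        qed
        then obtain v where v: "v \<in> F" "v \<in> S" "v \<noteq> u" by blast
        have "w \<in> {u, v}" if w: "w \<in> F \<inter> S" for w
        proof (rule ccontr)
          assume nw: "w \<notin> {u, v}"
          obtain s t where s: "v = u + s *\<^sub>R d" and t: "w = u + t *\<^sub>R d" using line v w by blast
          have mem: "u + 0 *\<^sub>R d \<in> F \<inter> S" "u + s *\<^sub>R d \<in> F \<inter> S" "u + t *\<^sub>R d \<in> F \<inter> S"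
            using u v w s t by auto
          have "s \<noteq> 0" "t \<noteq> 0" "s \<noteq> t" using s t nw v by auto
          \<comment> \<open>The six orders of 0, \<open>s\<close> and \<open>t\<close>, the
            parameters of \<open>u\<close>, \<open>v\<close> and \<open>w\<close> on the
            line.\<close>
          then consider "0 < s" "s < t" | "0 < t" "t < s" | "s < 0" "0 < t" | "t < 0" "0 < s"
            | "s < t" "t < 0" | "t < s" "s < 0" by linarith
          then show False using no3 mem by cases blast+
        qed
        then have FS: "F \<inter> S = {u, v}" using u v by blast
        have eq: "F = convex hull {u, v}" using gen unfolding FS .
        moreover have "{u, v} \<in> ?A" using F u v by (simp flip: eq)
        ultimately show "F \<in> (\<lambda>T. convex hull T) ` ?A" by (rule image_eqI)
      qed
    qed
  qed
  then show ?thesis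
    by (simp add: face_number_def bij_betw_same_card)
qed

text \<open>The generators of an arc f = {i, j} all arise from e_f + e_i + e_j by reversing the sign
  of one coordinate \<open>a\<close>; this form treats the three alike.\<close>

definition corner :: "'v set \<Rightarrow> 'v + 'v set \<Rightarrow> ('v + 'v set, real) poly_mapping" where
  "corner f a = arc_vec f + (\<Sum>i\<in>f. node_vec i) - Poly_Mapping.single a 2"

text \<open>Vertices are indexed by pairs, so that the arc of a vertex and its negative coordinate
  can be read off directly.\<close>

definition arc_corners :: "'v set set \<Rightarrow> ('v set \<times> ('v + 'v set)) set" where
  "arc_corners E = Sigma E (\<lambda>f. insert (Inr f) (Inl ` f))"

definition weighting :: "'a set \<Rightarrow> ('a \<Rightarrow> real) \<Rightarrow> ('a, real) poly_mapping \<Rightarrow> real" where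
  "weighting A c x = (\<Sum>a\<in>A. c a * Poly_Mapping.lookup x a)"

lemma linear_weighting: "linear (weighting A c)"
  unfolding weighting_def
  by (rule linearI)
    (simp_all add: lookup_add lookup_scaleR_poly_mapping sum.distrib sum_distrib_left algebra_simps)

lemma weighting_single:
  assumes "finite A" "a \<in> A"
  shows "weighting A c (Poly_Mapping.single a k) = k * c a"
proof -
  have "weighting A c (Poly_Mapping.single a k) = (\<Sum>b\<in>A. if b = a then k * c a else 0)"
    unfolding weighting_def by (intro sum.cong) (auto simp: lookup_single)
  then show ?thesis using assms by simp
qed

lemma weighting_corner:
  assumes "finite A" "Inr f \<in> A" "Inl ` f \<subseteq> A" "a \<in> A"
  shows "weighting A c (corner f a) = c (Inr f) + (\<Sum>i\<in>f. c (Inl i)) - 2 * c a"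
proof -
  note lin = linear_weighting[of A c]
  have "weighting A c (\<Sum>i\<in>f. node_vec i) = (\<Sum>i\<in>f. c (Inl i))"
    using assms by (subst linear_sum[OF lin]) (auto simp: node_vec_def weighting_single intro!: sum.cong)
  then show ?thesis
    using assms by (simp add: corner_def linear_diff[OF lin] linear_add[OF lin] weighting_single arc_vec_def)
qed

lemma lookup_corner:
  assumes "finite f"
  shows "Poly_Mapping.lookup (corner f a) b
    = of_bool (b = Inr f) + of_bool (b \<in> Inl ` f) - 2 * of_bool (b = a)"
proof -
  have "(\<Sum>i\<in>f. Poly_Mapping.lookup (node_vec i) b) = (of_bool (b \<in> Inl ` f) :: real)"
  proof (cases "b \<in> Inl ` f")
    case True
    then obtain j where j: "b = Inl j" "j \<in> f" by blast
    then have "(\<Sum>i\<in>f. Poly_Mapping.lookup (node_vec i) b) = (\<Sum>i\<in>f. if i = j then 1 else 0 :: real)"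
      by (intro sum.cong) (auto simp: node_vec_def lookup_single)
    then show ?thesis using j assms by simp
  qed (auto simp: node_vec_def lookup_single when_def intro!: sum.neutral)
  then show ?thesis
    by (auto simp: corner_def lookup_add lookup_minus lookup_sum arc_vec_def lookup_single when_def)
qed

section \<open>The vertices of a cosmological polytope and their exposing functionals\<close>

locale simple_graph =
  fixes G :: "'v graph"
  assumes simple: "finite_simple_graph G"
begin

abbreviation "V \<equiv> fst G"
abbreviation "E \<equiv> snd G"

definition "valency v = card {f \<in> E. v \<in> f}"

lemma finite_V: "finite V" and E_subset: "f \<in> E \<Longrightarrow> f \<subseteq> V" and card_arc: "f \<in> E \<Longrightarrow> card f = 2"
  using simple by (auto simp: finite_simple_graph_def)

lemma finite_E: "finite E"
  using finite_V E_subset by (auto intro: finite_subset[of E "Pow V"])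

lemma finite_arc: "f \<in> E \<Longrightarrow> finite f"
  using finite_V E_subset finite_subset by metis

lemma arc_obtain:
  assumes "f \<in> E" "i \<in> f"
  obtains j where "f = {i, j}" "i \<noteq> j"
  using card_arc[OF assms(1)] assms(2) by (auto simp: card_2_iff)

abbreviation "P \<equiv> cosmological_polytope G"
abbreviation "coords \<equiv> Inl ` V \<union> Inr ` E"
abbreviation "S \<equiv> case_prod corner ` arc_corners E"

lemma finite_arc_corners: "finite (arc_corners E)"
  unfolding arc_corners_def using finite_E finite_arc by blast

lemma card_arc_corners: "card (arc_corners E) = 3 * card E"
proof -
  have "card (insert (Inr f) (Inl ` f)) = 3" if "f \<in> E" for f :: "'v set"
    using card_arc[OF that] finite_arc[OF that]
    by (subst card_insert_disjoint) (auto simp: card_image)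
  then show ?thesis
    unfolding arc_corners_def using finite_E finite_arc by (subst card_SigmaI) auto
qed

lemma arc_cornersD:
  assumes "(f, a) \<in> arc_corners E"
  shows "f \<in> E" "a = Inr f \<or> (\<exists>i\<in>f. a = Inl i)" "Inr f \<in> coords" "Inl ` f \<subseteq> coords" "a \<in> coords"
  using assms E_subset by (auto simp: arc_corners_def)

lemma weighting_arc_corner:
  assumes "(f, a) \<in> arc_corners E"
  shows "weighting coords c (corner f a) = c (Inr f) + (\<Sum>i\<in>f. c (Inl i)) - 2 * c a"
  using assms arc_cornersD[OF assms] finite_V finite_E by (intro weighting_corner) auto

lemma polytope_eq: "P = convex hull S"
proof -
  have "corner {i, j} (Inr {i, j}) = node_vec i + node_vec j - arc_vec {i, j}"
       "corner {i, j} (Inl j) = node_vec i - node_vec j + arc_vec {i, j}"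
       "corner {i, j} (Inl i) = - node_vec i + node_vec j + arc_vec {i, j}" if "i \<noteq> j" for i j :: 'v
    using that
    by (auto intro!: poly_mapping_eqI
        simp: lookup_corner lookup_add lookup_minus node_vec_def arc_vec_def lookup_single when_def)
  note c = this
  have "(\<Union>{ { node_vec i + node_vec j - arc_vec {i, j},
           node_vec i - node_vec j + arc_vec {i, j},
           - node_vec i + node_vec j + arc_vec {i, j} } | i j. {i, j} \<in> E }) = S" (is "\<Union>?C = _")
  proof
    show "\<Union>?C \<subseteq> S"
    proof
      fix x assume "x \<in> \<Union>?C"
      then obtain i j where ij: "{i, j} \<in> E" and x: "x \<in> { node_vec i + node_vec j - arc_vec {i, j},
           node_vec i - node_vec j + arc_vec {i, j}, - node_vec i + node_vec j + arc_vec {i, j} }"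
        by blast
      have "i \<noteq> j" using card_arc[OF ij] by auto
      then have "x \<in> corner {i, j} ` {Inr {i, j}, Inl j, Inl i}" using x by (auto simp: c)
      then show "x \<in> S" using ij by (force simp: arc_corners_def)
    qed
    show "S \<subseteq> \<Union>?C"
    proof clarify
      fix f a assume fa: "(f, a) \<in> arc_corners E"
      then obtain i j where f: "f = {i, j}" "i \<noteq> j"
        using card_arc[OF arc_cornersD(1)[OF fa]] by (auto simp: card_2_iff)
      have "{i, j} \<in> E" using fa f arc_cornersD(1) by blast
      moreover have "corner f a \<in> { node_vec i + node_vec j - arc_vec {i, j},
           node_vec i - node_vec j + arc_vec {i, j}, - node_vec i + node_vec j + arc_vec {i, j} }"
        using arc_cornersD(2)[OF fa] f by (auto simp: c)
      ultimately show "corner f a \<in> \<Union>?C" by blast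
    qed
  qed
  then show ?thesis by (simp add: cosmological_polytope_def)
qed

text \<open>The coordinate of \<open>f\<close> is 1 or -1 at the corners of \<open>f\<close> and 0
  at those of any other arc, which recovers the arc; \<open>a\<close> is then the only negative
  coordinate.\<close>

lemma inj_on_corner: "inj_on (case_prod corner) (arc_corners E)"
proof (rule inj_onI, clarify)
  fix f a g b
  assume fa: "(f, a) \<in> arc_corners E" and gb: "(g, b) \<in> arc_corners E"
    and eq: "corner f a = corner g b"
  note l = lookup_corner[OF finite_arc[OF arc_cornersD(1)[OF fa]]]
    lookup_corner[OF finite_arc[OF arc_cornersD(1)[OF gb]]]
  have fg: "f = g"
    using arg_cong[OF eq, of "\<lambda>x. Poly_Mapping.lookup x (Inr f)"] arc_cornersD(2)[OF gb]
    by (auto simp: l of_bool_def split: if_splits)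
  have "a = b"
    using arg_cong[OF eq, of "\<lambda>x. Poly_Mapping.lookup x a"]
    by (auto simp: l fg of_bool_def split: if_splits)
  then show "f = g \<and> a = b" using fg by simp
qed

lemma face_of_corners:
  fixes c :: "'v + 'v set \<Rightarrow> real"
  assumes "T \<subseteq> arc_corners E"
    and "\<And>f a. (f, a) \<in> T \<Longrightarrow> c (Inr f) + (\<Sum>i\<in>f. c (Inl i)) - 2 * c a = M"
    and "\<And>f a. (f, a) \<in> arc_corners E - T \<Longrightarrow> c (Inr f) + (\<Sum>i\<in>f. c (Inl i)) - 2 * c a < M"
  shows "convex hull (case_prod corner ` T) face_of P"
  unfolding polytope_eq
proof (rule face_of_convex_hull_exposed[OF _ _ linear_weighting[of coords c], where M = M])
  show "weighting coords c x = M" if "x \<in> case_prod corner ` T" for x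
    using that assms(1,2) by (auto simp: weighting_arc_corner subset_iff)
  show "weighting coords c x < M" if x: "x \<in> S - case_prod corner ` T" for x
  proof -
    obtain f a where "x = corner f a" "(f, a) \<in> arc_corners E - T" using x by auto
    then show ?thesis using assms(3) by (simp add: weighting_arc_corner)
  qed
qed (use assms(1) finite_arc_corners in auto)

text \<open>Node weights below 1 extend to a functional that is less than 1 at the corners of any
  prescribed arc; an arc can moreover be made to attain 1 at a single corner, provided the weights
  strictly increase along the arc from the node subtracted there.\<close>

lemma face_of_corners_node_weights:
  assumes T: "T \<subseteq> arc_corners E" and uniq: "\<And>f a b. (f, a) \<in> T \<Longrightarrow> (f, b) \<in> T \<Longrightarrow> a = b"
    and w1: "\<And>v. w v < (1::real)"
    and w: "\<And>f i j. (f, Inl j) \<in> T \<Longrightarrow> i \<in> f \<Longrightarrow> i \<noteq> j \<Longrightarrow> w j < w i"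
  shows "convex hull (case_prod corner ` T) face_of P"
proof -
  \<comment> \<open>The first two values of the arc weight solve for the value 1 at the selected
    corner. With the minimum, no corner of an unselected arc exceeds the larger of its two node
    weights, which is below 1. The description operator is well defined by
    \<open>uniq\<close>.\<close>
  define c where "c x = (case x of Inl v \<Rightarrow> w v | Inr f \<Rightarrow>
     if (f, Inr f) \<in> T then sum w f - 1
     else if \<exists>j. (f, Inl j) \<in> T then 1 - sum w f + 2 * w (THE j. (f, Inl j) \<in> T)
     else Min (w ` f))" for x
  have cI [simp]: "c (Inl v) = w v" for v by (simp add: c_def)
  show ?thesis
  proof (rule face_of_corners[where c = c and M = 1, OF T])
    fix f a assume fa: "(f, a) \<in> T"
    then have fa': "(f, a) \<in> arc_corners E" using T by blast
    from arc_cornersD(2)[OF fa'] show "c (Inr f) + (\<Sum>i\<in>f. c (Inl i)) - 2 * c a = 1"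
    proof
      assume "a = Inr f" then show ?thesis using fa by (simp add: c_def)
    next
      assume "\<exists>i\<in>f. a = Inl i"
      then obtain j where j: "a = Inl j" by blast
      then have "(f, Inr f) \<notin> T" using uniq[OF fa, of "Inr f"] by auto
      moreover have "(THE j. (f, Inl j) \<in> T) = j"
        using fa uniq[OF fa] unfolding j by (intro the_equality) blast+
      ultimately show ?thesis using fa j by (auto simp: c_def)
    qed
  next
    fix f a assume fa: "(f, a) \<in> arc_corners E - T"
    then have f: "f \<in> E" using arc_cornersD(1) by blast
    have "c (Inr f) + sum w f - 2 * c a < 1"
    proof (cases "(f, Inr f) \<in> T")
      case True
      then have "a \<noteq> Inr f" using fa by auto
      then obtain i where i: "i \<in> f" "a = Inl i" using arc_cornersD(2) fa by blast
      obtain j where "f = {i, j}" "i \<noteq> j" using arc_obtain[OF f i(1)] .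
      then show ?thesis using True i w1[of j] by (simp add: c_def)
    next
      case nr: False
      show ?thesis
      proof (cases "\<exists>j. (f, Inl j) \<in> T")
        case True
        then obtain j where j: "(f, Inl j) \<in> T" by blast
        then have "j \<in> f" using T by (auto simp: arc_corners_def)
        then obtain i where i: "f = {j, i}" "j \<noteq> i" using arc_obtain[OF f] by blast
        have "(THE j. (f, Inl j) \<in> T) = j"
          using j uniq[OF j] by (intro the_equality) blast+
        then have cf: "c (Inr f) = 1 - w i + w j" using nr True i by (simp add: c_def)
        have "a \<noteq> Inl j" using fa j by auto
        moreover have "a = Inr f \<or> (\<exists>v\<in>f. a = Inl v)" using arc_cornersD(2) fa by blast
        ultimately have "a = Inr f \<or> a = Inl i" unfolding i(1) by auto
        then show ?thesis using cf i(2) w1[of i] w[OF j, of i] by (auto simp: i(1))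
      next
        case False
        obtain i j where i: "f = {i, j}" "i \<noteq> j" using card_arc[OF f] by (auto simp: card_2_iff)
        then have cf: "c (Inr f) = min (w i) (w j)" using nr False by (simp add: c_def)
        have "a = Inr f \<or> a = Inl i \<or> a = Inl j" using arc_cornersD(2)[of f a] fa i by auto
        then show ?thesis using cf i w1[of i] w1[of j] by (auto simp: min_def)
      qed
    qed
    then show "c (Inr f) + (\<Sum>i\<in>f. c (Inl i)) - 2 * c a < 1" by simp
  qed
qed

section \<open>Which pairs of vertices span an edge\<close>

lemma corner_face_of:
  assumes "(f, a) \<in> arc_corners E"
  shows "{corner f a} face_of P"
proof -
  have "convex hull (case_prod corner ` {(f, a)}) face_of P"
    by (rule face_of_corners_node_weights[where w = "\<lambda>v. if a = Inl v then -1 else 0"])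
      (use assms in auto)
  then show ?thesis by simp
qed

text \<open>It suffices to find node weights that increase away from the subtracted node on both
  arcs at once. Different arcs share at most one node, so the two requirements do not
  conflict.\<close>

lemma distinct_arcs_face_of:
  assumes fa: "(f, a) \<in> arc_corners E" and gb: "(g, b) \<in> arc_corners E" and "f \<noteq> g"
  shows "convex hull {corner f a, corner g b} face_of P"
proof -
  have "\<exists>w. (\<forall>v. w v < (1::real)) \<and> (\<forall>i j. a = Inl j \<longrightarrow> i \<in> f \<longrightarrow> i \<noteq> j \<longrightarrow> w j < w i)
      \<and> (\<forall>i j. b = Inl j \<longrightarrow> i \<in> g \<longrightarrow> i \<noteq> j \<longrightarrow> w j < w i)"
  \<comment> \<open>The smallest weight -2 goes to a subtracted node that imposes nothing on the
    other arc: to that of \<open>f\<close> unless it lies on \<open>g\<close>, and otherwise to that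
    of \<open>g\<close>, which is then off \<open>f\<close> or the same node.\<close>
  proof (cases "\<exists>j l. a = Inl j \<and> b = Inl l \<and> j \<in> g")
    case False
    then show ?thesis
      by (intro exI[of _ "\<lambda>v. if a = Inl v then -2 else if b = Inl v then -1 else 0"]) auto
  next
    case True
    then obtain j l where jl: "a = Inl j" "b = Inl l" "j \<in> g" by blast
    have "l \<notin> f \<or> l = j"
    proof (rule ccontr)
      assume "\<not> ?thesis"
      then have "l \<in> f" "l \<noteq> j" by auto
      moreover have "j \<in> f" "l \<in> g" using fa gb jl by (auto simp: arc_corners_def)
      moreover have "f \<in> E" "g \<in> E" using arc_cornersD(1) fa gb by blast+
      ultimately have "f = {j, l}" "g = {j, l}"
        using jl(3) by (metis arc_obtain insert_iff singletonD)+
      then show False using \<open>f \<noteq> g\<close> by simp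
    qed
    then show ?thesis
      by (intro exI[of _ "\<lambda>v. if v = l then -2 else if v = j then -1 else 0"]) (auto simp: jl)
  qed
  then obtain w where w: "\<And>v. w v < (1::real)" "\<And>i j. a = Inl j \<Longrightarrow> i \<in> f \<Longrightarrow> i \<noteq> j \<Longrightarrow> w j < w i"
      "\<And>i j. b = Inl j \<Longrightarrow> i \<in> g \<Longrightarrow> i \<noteq> j \<Longrightarrow> w j < w i" by metis
  have "convex hull (case_prod corner ` {(f, a), (g, b)}) face_of P"
    by (rule face_of_corners_node_weights[where w = w]) (use fa gb w \<open>f \<noteq> g\<close> in auto)
  then show ?thesis by simp
qed

text \<open>The coordinate of \<open>f\<close> exposes this pair: it is 1 at these two corners, -1
  at the third corner of \<open>f\<close> and 0 at the corners of other arcs.\<close>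

lemma opposite_corners_face_of:
  assumes "f \<in> E" "f = {i, j}" "i \<noteq> j"
  shows "convex hull {corner f (Inl i), corner f (Inl j)} face_of P"
proof -
  have "convex hull (case_prod corner ` {(f, Inl i), (f, Inl j)}) face_of P"
    by (rule face_of_corners[where c = "\<lambda>x. of_bool (x = Inr f)" and M = 1])
      (use assms in \<open>auto simp: arc_corners_def of_bool_def split: if_splits\<close>)
  then show ?thesis by simp
qed

text \<open>If \<open>f\<close> is the only arc at \<open>i\<close>, the coordinate of
  \<open>i\<close> exposes the pair. A second arc \<open>g\<close> at \<open>i\<close> has a pair
  with the same midpoint e_i, so a face containing the first segment would have to contain corners
  of \<open>g\<close> as well.\<close>

lemma adjacent_corners_face_of_iff:
  assumes f: "f \<in> E" "f = {i, j}" "i \<noteq> j"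
  shows "convex hull {corner f (Inr f), corner f (Inl j)} face_of P \<longleftrightarrow> valency i < 2"
proof
  assume deg: "valency i < 2"
  have only: "h = f" if "h \<in> E" "i \<in> h" for h
  proof (rule ccontr)
    assume "h \<noteq> f"
    have "card {f, h} \<le> valency i"
      unfolding valency_def using that f finite_E by (intro card_mono) auto
    then show False using deg \<open>h \<noteq> f\<close> by auto
  qed
  have sum: "(\<Sum>v\<in>h. of_bool (Inl v = (Inl i :: 'v + 'v set))) = (of_bool (i \<in> h) :: real)" if "h \<in> E" for h
    using finite_arc[OF that] by (simp add: of_bool_def sum.delta)
  have "convex hull (case_prod corner ` {(f, Inr f), (f, Inl j)}) face_of P"
  proof (rule face_of_corners[where c = "\<lambda>x. of_bool (x = Inl i)" and M = 1])
    show "of_bool (Inr h = Inl i) + (\<Sum>v\<in>h. of_bool (Inl v = Inl i)) - 2 * of_bool (a = Inl i) < (1::real)"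
      if "(h, a) \<in> arc_corners E - {(f, Inr f), (f, Inl j)}" for h a
    proof -
      have "i \<notin> h \<or> a = Inl i"
      proof (rule ccontr)
        assume n: "\<not> (i \<notin> h \<or> a = Inl i)"
        then have "h = f" using that only[of h] arc_cornersD(1) by blast
        then show False using that n f(2) arc_cornersD(2)[of h a] by auto
      qed
      moreover have "h \<in> E" using that arc_cornersD(1) by blast
      ultimately show ?thesis using sum by auto
    qed
  qed (use f sum in \<open>auto simp: arc_corners_def\<close>)
  then show "convex hull {corner f (Inr f), corner f (Inl j)} face_of P" by simp
next
  let ?u = "corner f (Inr f)" and ?v = "corner f (Inl j)"
  assume face: "convex hull {?u, ?v} face_of P"
  show "valency i < 2"
  proof (rule ccontr)
    assume "\<not> valency i < 2"
    then have "\<not> {h \<in> E. i \<in> h} \<subseteq> {f}"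
      unfolding valency_def using card_mono[of "{f}" "{h \<in> E. i \<in> h}"] by fastforce
    then obtain g where g: "g \<in> E" "i \<in> g" "g \<noteq> f" by blast
    then obtain k where k: "g = {i, k}" "i \<noteq> k" using arc_obtain by blast
    let ?x = "corner g (Inr g)" and ?y = "corner g (Inl k)"
    have two: "corner {i, l} (Inr {i, l}) + corner {i, l} (Inl l) = 2 *\<^sub>R node_vec i" if "i \<noteq> l" for l
      using that by (intro poly_mapping_eqI)
        (auto simp: lookup_add lookup_corner lookup_scaleR_poly_mapping node_vec_def lookup_single when_def)
    have eq: "(1/2) *\<^sub>R ?u + (1/2) *\<^sub>R ?v = (1/2) *\<^sub>R ?x + (1/2) *\<^sub>R ?y"
      using two[OF f(3)] two[OF k(2)] f(2) k(1) by (simp flip: scaleR_add_right)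
    have gc: "(g, Inr g) \<in> arc_corners E" "(g, Inl k) \<in> arc_corners E"
      using g k by (auto simp: arc_corners_def)
    have "?x \<in> P" "?y \<in> P" unfolding polytope_eq using gc by (auto intro!: hull_inc)
    moreover have "?x \<noteq> ?y" using inj_onD[OF inj_on_corner, of "(g, Inr g)" "(g, Inl k)"] gc by auto
    then have "(1/2) *\<^sub>R ?x + (1/2) *\<^sub>R ?y \<in> open_segment ?x ?y"
      by (auto simp: in_segment intro!: exI[of _ "1/2"])
    moreover have "(1/2) *\<^sub>R ?x + (1/2) *\<^sub>R ?y \<in> convex hull {?u, ?v}"
      unfolding eq[symmetric] convex_hull_2 by (auto intro!: exI[of _ "1/2"])
    ultimately have "?x \<in> convex hull {?u, ?v}"
      using face_ofD[OF face] by blast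
    then obtain s t where "?x = s *\<^sub>R ?u + t *\<^sub>R ?v" unfolding convex_hull_2 by blast
    \<comment> \<open>The coordinate of \<open>g\<close> is -1 at \<open>?x\<close> but vanishes at
      both corners of \<open>f\<close>.\<close>
    then have "Poly_Mapping.lookup ?x (Inr g) = Poly_Mapping.lookup (s *\<^sub>R ?u + t *\<^sub>R ?v) (Inr g)"
      by simp
    then show False
      using g f finite_arc
      by (auto simp: lookup_add lookup_scaleR_poly_mapping lookup_corner)
  qed
qed

text \<open>For a node \<open>i\<close> of valency at least 2 and an arc \<open>f\<close> at
  \<open>i\<close>, this collects the indices of the two corners of \<open>f\<close> with midpoint
  e_i. Removing \<open>i\<close> from \<open>f\<close> picks the other end without naming
  it.\<close>

definition non_edges :: "('v set \<times> ('v + 'v set)) set set" where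
  "non_edges = (\<lambda>(i, f). Pair f ` insert (Inr f) (Inl ` (f - {i}))) ` Sigma {i \<in> V. 2 \<le> valency i} (\<lambda>i. {f \<in> E. i \<in> f})"

text \<open>A pair in \<open>non_edges\<close> determines its arc and the node of that arc that it
  leaves out, so the pairs correspond to incidences of arcs with nodes of valency at least
  2.\<close>

lemma card_non_edges: "card non_edges = (\<Sum>v\<in>V. if 2 \<le> valency v then valency v else 0)"
proof -
  have "inj_on (\<lambda>(i, f). Pair f ` insert (Inr f) (Inl ` (f - {i}))) (Sigma {i \<in> V. 2 \<le> valency i} (\<lambda>i. {f \<in> E. i \<in> f}))"
  proof (rule inj_onI, clarify)
    fix i j :: 'v and f g :: "'v set"
    assume ig: "i \<in> f" "j \<in> g"
      and eq: "Pair f ` insert (Inr f) (Inl ` (f - {i})) = Pair g ` insert (Inr g) (Inl ` (g - {j}))"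
    have "(f, Inr f) \<in> Pair g ` insert (Inr g) (Inl ` (g - {j}))" by (subst eq[symmetric]) simp
    then have fg: "f = g" by blast
    have "(f, Inl i) \<notin> Pair f ` insert (Inr f) (Inl ` (f - {i}))" by blast
    then have "i = j" unfolding eq using fg ig by blast
    then show "i = j \<and> f = g" using fg by simp
  qed
  then have "card non_edges = card (Sigma {i \<in> V. 2 \<le> valency i} (\<lambda>i. {f \<in> E. i \<in> f}))"
    unfolding non_edges_def by (rule card_image)
  also have "\<dots> = (\<Sum>i\<in>{i \<in> V. 2 \<le> valency i}. valency i)"
    using finite_V finite_E by (subst card_SigmaI) (auto simp: valency_def)
  also have "\<dots> = (\<Sum>v\<in>V. if 2 \<le> valency v then valency v else 0)"
    using finite_V by (subst sum.inter_filter) auto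
  finally show ?thesis .
qed

lemma non_edgesI:
  assumes "f \<in> E" "f = {i, j}" "i \<noteq> j" "2 \<le> valency i"
  shows "{(f, Inr f), (f, Inl j)} \<in> non_edges"
proof -
  have "(i, f) \<in> Sigma {i \<in> V. 2 \<le> valency i} (\<lambda>i. {f \<in> E. i \<in> f})" using assms E_subset[OF assms(1)] by auto
  then have "Pair f ` insert (Inr f) (Inl ` (f - {i})) \<in> non_edges"
    unfolding non_edges_def by (rule rev_image_eqI) simp
  moreover have "f - {i} = {j}" using assms by auto
  ultimately show ?thesis by simp
qed

lemma non_edgesE:
  assumes "T \<in> non_edges"
  obtains f i j where "f \<in> E" "f = {i, j}" "i \<noteq> j" "2 \<le> valency i" "T = {(f, Inr f), (f, Inl j)}"
proof -
  from assms obtain i f where i: "2 \<le> valency i" "f \<in> E" "i \<in> f"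
    and T: "T = Pair f ` insert (Inr f) (Inl ` (f - {i}))"
    unfolding non_edges_def by auto
  obtain j where j: "f = {i, j}" "i \<noteq> j" using arc_obtain i by blast
  then have "f - {i} = {j}" by auto
  then show ?thesis using that i j T by simp
qed

lemma non_edges_subset: "non_edges \<subseteq> {T. T \<subseteq> arc_corners E \<and> card T = 2}"
  by (auto elim!: non_edgesE simp: arc_corners_def)

text \<open>Two corners come from different arcs, or are both node corners of one arc, or are its
  arc corner and a node corner. Only the last kind can occur in \<open>non_edges\<close>.\<close>

lemma corners_face_of_iff:
  assumes T: "T \<subseteq> arc_corners E" "card T = 2"
  shows "convex hull (case_prod corner ` T) face_of P \<longleftrightarrow> T \<notin> non_edges"
proof -
  obtain f a g b where fg: "T = {(f, a), (g, b)}" "(f, a) \<noteq> (g, b)"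
    using T(2) by (auto simp: card_2_iff)
  have fa: "(f, a) \<in> arc_corners E" and gb: "(g, b) \<in> arc_corners E" using T fg by auto
  have f: "f \<in> E" using fa arc_cornersD(1) by blast
  have adj: "convex hull (case_prod corner ` T) face_of P \<longleftrightarrow> T \<notin> non_edges"
    if T': "T = {(f, Inr f), (f, Inl j)}" and j: "j \<in> f" for j
  proof -
    obtain i where i: "f = {i, j}" "i \<noteq> j" using arc_obtain[OF f j] by (metis insert_commute)
    have "T \<in> non_edges \<longleftrightarrow> 2 \<le> valency i"
    proof
      assume "T \<in> non_edges"
      then obtain f' i' j' where *: "f' = {i', j'}" "i' \<noteq> j'" "2 \<le> valency i'" "T = {(f', Inr f'), (f', Inl j')}"
        using non_edgesE by metis
      then have "(f', Inr f') \<in> {(f, Inr f), (f, Inl j)}" "(f', Inl j') \<in> {(f, Inr f), (f, Inl j)}"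
        using T' by auto
      then have "f' = f" "j' = j" by auto
      then have "i' = i" using i * by (auto simp: doubleton_eq_iff)
      then show "2 \<le> valency i" using * by simp
    qed (use non_edgesI[OF f i] T' in simp)
    then show ?thesis using adjacent_corners_face_of_iff[OF f i] T' by auto
  qed
  show ?thesis
  proof (cases "f = g")
    case False
    have "T \<notin> non_edges"
    proof
      assume "T \<in> non_edges"
      then obtain f' j where "T = {(f', Inr f'), (f', Inl j)}" using non_edgesE by metis
      then have "{(f, a), (g, b)} = {(f', Inr f'), (f', Inl j)}" unfolding fg(1) .
      then have "f = f' \<and> g = f'" by (auto simp only: doubleton_eq_iff)
      then show False using False by simp
    qed
    then show ?thesis using distinct_arcs_face_of[OF fa gb False] fg by simp
  next
    case True
    from arc_cornersD(2)[OF fa] arc_cornersD(2)[OF gb] fg(2) True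
    consider j where "j \<in> f" "a = Inr f" "b = Inl j" | j where "j \<in> f" "b = Inr f" "a = Inl j"
      | i j where "i \<in> f" "j \<in> f" "i \<noteq> j" "a = Inl i" "b = Inl j"
      by auto
    then show ?thesis
    proof cases
      case 1 then show ?thesis using adj True fg by simp
    next
      case 2 then show ?thesis using adj True fg by (simp add: insert_commute)
    next
      case 3
      then have "f = {i, j}" using arc_obtain[OF f] by (metis insert_iff singletonD)
      moreover have "T \<notin> non_edges"
      proof
        assume "T \<in> non_edges"
        then obtain f' j' where "T = {(f', Inr f'), (f', Inl j')}" using non_edgesE by metis
        then have "{(f, a), (g, b)} = {(f', Inr f'), (f', Inl j')}" unfolding fg(1) .
        then have "a = Inr f' \<or> b = Inr f'" by (auto simp only: doubleton_eq_iff)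
        then show False using 3 by auto
      qed
      ultimately show ?thesis using opposite_corners_face_of[OF f] 3 True fg by simp
    qed
  qed
qed

text \<open>All pairs of the \<open>3 * card E\<close> vertices are edges except those in
  \<open>non_edges\<close>. The additive form avoids truncated subtraction.\<close>

theorem face_number_1_cosmological_polytope:
  "face_number 1 P + (\<Sum>v\<in>V. if 2 \<le> valency v then valency v else 0) = (3 * card E) choose 2"
proof -
  let ?pairs = "{T. T \<subseteq> arc_corners E \<and> card T = 2}"
  have "face_number 1 P = card {T. T \<subseteq> S \<and> card T = 2 \<and> convex hull T face_of P}"
    unfolding polytope_eq using finite_arc_corners corner_face_of polytope_eq
    by (intro face_number_1_convex_hull) auto
  also have "{T. T \<subseteq> S \<and> card T = 2 \<and> convex hull T face_of P}
      = (\<lambda>T. case_prod corner ` T) ` (?pairs - non_edges)" (is "?L = ?R")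
  proof
    show "?R \<subseteq> ?L"
      using corners_face_of_iff inj_on_corner by (auto simp: card_image inj_on_subset)
    show "?L \<subseteq> ?R"
    proof
      fix U assume U: "U \<in> ?L"
      then obtain T where T: "T \<subseteq> arc_corners E" "U = case_prod corner ` T"
        by (auto simp: subset_image_iff)
      then have "card T = 2" using U inj_on_corner by (auto simp: card_image inj_on_subset)
      then show "U \<in> ?R" using T U corners_face_of_iff by auto
    qed
  qed
  also have "card \<dots> = card (?pairs - non_edges)"
    using inj_on_image_Pow[OF inj_on_corner] by (intro card_image) (auto elim: inj_on_subset)
  also have "\<dots> = card ?pairs - card non_edges"
    using non_edges_subset finite_arc_corners
    by (intro card_Diff_subset) (auto intro: finite_subset[OF non_edges_subset])
  finally have "face_number 1 P = card ?pairs - card non_edges" .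
  moreover have "card non_edges \<le> card ?pairs"
    using non_edges_subset finite_arc_corners by (intro card_mono) auto
  moreover have "card ?pairs = (3 * card E) choose 2"
    using n_subsets[OF finite_arc_corners] card_arc_corners by simp
  ultimately show ?thesis using card_non_edges by simp
qed

end

section \<open>Functions of independent bits\<close>

abbreviation bits :: "'a set \<Rightarrow> real \<Rightarrow> ('a \<Rightarrow> bool) pmf" where
  "bits A p \<equiv> Pi_pmf A False (\<lambda>_. bernoulli_pmf p)"

lemma finite_set_bits: "finite A \<Longrightarrow> finite (set_pmf (bits A p))"
  by (rule finite_subset[OF set_Pi_pmf_subset']) auto

lemma integrable_bits [simp]:
  fixes F :: "('a \<Rightarrow> bool) \<Rightarrow> real"
  shows "finite A \<Longrightarrow> integrable (measure_pmf (bits A p)) F"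
  by (intro integrable_measure_pmf_finite finite_set_bits)

lemma expectation_square_diff:
  fixes F :: "'a \<Rightarrow> real"
  assumes "finite (set_pmf M)"
  shows "measure_pmf.expectation M (\<lambda>x. (F x - c)\<^sup>2)
      = measure_pmf.variance M F + (measure_pmf.expectation M F - c)\<^sup>2"
proof -
  note int [simp] = integrable_measure_pmf_finite[OF assms]
  let ?m = "measure_pmf.expectation M F"
  have "measure_pmf.expectation M (\<lambda>x. (F x - c)\<^sup>2)
      = measure_pmf.expectation M (\<lambda>x. (F x - ?m)\<^sup>2 + 2 * (?m - c) * (F x - ?m) + (?m - c)\<^sup>2)"
    by (intro Bochner_Integration.integral_cong) (auto simp: power2_eq_square algebra_simps)
  then show ?thesis by (simp add: measure_pmf.prob_space)
qed

section \<open>Conditioning on a single bit, discrete integration by parts and the Efron-Stein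
  inequality\<close>

context
  fixes p :: real
  assumes p: "0 < p" "p < 1"
begin

lemma expectation_bits_insert:
  fixes F :: "('a \<Rightarrow> bool) \<Rightarrow> real"
  assumes A: "finite A" "x \<notin> A"
  shows "measure_pmf.expectation (bits (insert x A) p) F
    = p * measure_pmf.expectation (bits A p) (\<lambda>X. F (X(x := True)))
      + (1 - p) * measure_pmf.expectation (bits A p) (\<lambda>X. F (X(x := False)))"
proof -
  have "bits (insert x A) p = bernoulli_pmf p \<bind> (\<lambda>y. map_pmf (\<lambda>f. f(x := y)) (bits A p))"
    using A by (simp add: Pi_pmf_insert' map_pmf_def)
  then show ?thesis
    using A p finite_set_bits[OF A(1)]
    by (simp add: pmf_expectation_bind[of UNIV] UNIV_bool)
qed

text \<open>Conditioning on a bit already in \<open>A\<close>: the functions on the right ignore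
  that bit, so averaging them over \<open>A - {x}\<close> or over \<open>A\<close> is the
  same.\<close>

lemma expectation_bits_split:
  fixes F :: "('a \<Rightarrow> bool) \<Rightarrow> real"
  assumes A: "finite A" "x \<in> A"
  shows "measure_pmf.expectation (bits A p) F
    = p * measure_pmf.expectation (bits A p) (\<lambda>X. F (X(x := True)))
      + (1 - p) * measure_pmf.expectation (bits A p) (\<lambda>X. F (X(x := False)))"
proof -
  have ins: "insert x (A - {x}) = A" using A by blast
  note split = expectation_bits_insert[of "A - {x}" x, unfolded ins]
  have "measure_pmf.expectation (bits A p) (\<lambda>X. F (X(x := b)))
      = measure_pmf.expectation (bits (A - {x}) p) (\<lambda>X. F (X(x := b)))" for b
    using A by (subst split) (simp_all add: algebra_simps)
  then show ?thesis using A split[of F] by simp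
qed

text \<open>The centred bit is 1 - p with probability p and -p with probability 1 - p, so
  conditioning on it produces the difference of the two values of \<open>F\<close>.\<close>

lemma bits_integration_by_parts:
  fixes F :: "('a \<Rightarrow> bool) \<Rightarrow> real"
  assumes A: "finite A" "x \<in> A"
  shows "measure_pmf.expectation (bits A p) (\<lambda>X. (of_bool (X x) - p) * F X)
    = p * (1 - p) * measure_pmf.expectation (bits A p) (\<lambda>X. F (X(x := True)) - F (X(x := False)))"
  by (subst expectation_bits_split[OF A]) (use A in \<open>simp add: algebra_simps\<close>)

text \<open>Induction over the bits: given the new bit, the conditional variances are bounded by the
  induction hypothesis, and the variance of the conditional mean contributes the summand of the new
  bit.\<close>

theorem efron_stein_bits:
  fixes F :: "('a \<Rightarrow> bool) \<Rightarrow> real"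
  assumes "finite A"
  shows "measure_pmf.variance (bits A p) F \<le> p * (1 - p) *
    (\<Sum>x\<in>A. measure_pmf.expectation (bits A p) (\<lambda>X. (F (X(x := True)) - F (X(x := False)))\<^sup>2))"
  using assms
proof (induction A arbitrary: F rule: finite_induct)
  case empty
  then show ?case by simp
next
  case (insert x A)
  let ?E = "measure_pmf.expectation (bits A p)"
  let ?E' = "measure_pmf.expectation (bits (insert x A) p)"
  define F1 F0 where "F1 = (\<lambda>X. F (X(x := True)))" and "F0 = (\<lambda>X. F (X(x := False)))"
  define D where "D y F X = F (X(y := True)) - F (X(y := False))" for y and F :: "('a \<Rightarrow> bool) \<Rightarrow> real" and X
  have [simp]: "finite A" "finite (set_pmf (bits A p))" using insert finite_set_bits by auto
  note split = expectation_bits_insert[OF insert(1,2)]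
  have IH: "measure_pmf.variance (bits A p) F \<le> p * (1 - p) * (\<Sum>y\<in>A. ?E (\<lambda>X. (D y F X)\<^sup>2))" for F
    unfolding D_def by (rule insert.IH)
  define m where "m = ?E' F"
  have m: "m = p * ?E F1 + (1 - p) * ?E F0"
    by (simp add: m_def split F1_def F0_def)
  have "measure_pmf.variance (bits (insert x A) p) F
      = p * ?E (\<lambda>X. (F1 X - m)\<^sup>2) + (1 - p) * ?E (\<lambda>X. (F0 X - m)\<^sup>2)"
    unfolding m_def[symmetric] by (subst split) (simp add: F1_def F0_def)
  \<comment> \<open>Law of total variance for a bit choosing between \<open>F1\<close> and
    \<open>F0\<close>.\<close>
  also have "\<dots> = p * measure_pmf.variance (bits A p) F1 + (1 - p) * measure_pmf.variance (bits A p) F0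
      + p * (1 - p) * (?E F1 - ?E F0)\<^sup>2"
    unfolding expectation_square_diff[of "bits A p" F1 m, simplified] expectation_square_diff[of "bits A p" F0 m, simplified] m
    by (simp add: power2_eq_square algebra_simps)
  also have "\<dots> \<le> p * (p * (1 - p) * (\<Sum>y\<in>A. ?E (\<lambda>X. (D y F1 X)\<^sup>2)))
      + (1 - p) * (p * (1 - p) * (\<Sum>y\<in>A. ?E (\<lambda>X. (D y F0 X)\<^sup>2)))
      + p * (1 - p) * ?E (\<lambda>X. (F1 X - F0 X)\<^sup>2)"
  proof (intro add_mono mult_left_mono)
    have "(?E F1 - ?E F0)\<^sup>2 = (?E (\<lambda>X. F1 X - F0 X))\<^sup>2" by simp
    also have "\<dots> \<le> ?E (\<lambda>X. (F1 X - F0 X)\<^sup>2)"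
      using expectation_square_diff[of "bits A p" "\<lambda>X. F1 X - F0 X" 0]
      by simp
    finally show "(?E F1 - ?E F0)\<^sup>2 \<le> ?E (\<lambda>X. (F1 X - F0 X)\<^sup>2)" .
  qed (use p IH in auto)
  also have "\<dots> = p * (1 - p) * (\<Sum>y\<in>insert x A. ?E' (\<lambda>X. (D y F X)\<^sup>2))"
  proof -
    have "?E' (\<lambda>X. (D x F X)\<^sup>2) = ?E (\<lambda>X. (F1 X - F0 X)\<^sup>2)"
      by (subst split) (simp add: D_def F1_def F0_def algebra_simps)
    moreover have "?E' (\<lambda>X. (D y F X)\<^sup>2) = p * ?E (\<lambda>X. (D y F1 X)\<^sup>2) + (1 - p) * ?E (\<lambda>X. (D y F0 X)\<^sup>2)"
      if "y \<in> A" for y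
    proof -
      have "y \<noteq> x" using that insert by auto
      then show ?thesis by (subst split) (simp add: D_def F1_def F0_def fun_upd_twist)
    qed
    then have "(\<Sum>y\<in>A. ?E' (\<lambda>X. (D y F X)\<^sup>2)) = p * (\<Sum>y\<in>A. ?E (\<lambda>X. (D y F1 X)\<^sup>2))
        + (1 - p) * (\<Sum>y\<in>A. ?E (\<lambda>X. (D y F0 X)\<^sup>2))"
      by (simp add: sum.distrib sum_distrib_left)
    ultimately show ?thesis
      unfolding sum.insert[OF insert(1,2)] by (simp only:) (simp add: algebra_simps)
  qed
  finally show ?case unfolding D_def .
qed

end

section \<open>The number of ones, its mean and its variance\<close>

definition ones :: "'a set \<Rightarrow> ('a \<Rightarrow> bool) \<Rightarrow> real" where
  "ones A X = real (card {a \<in> A. X a})"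

lemma ones_eq_sum: "finite A \<Longrightarrow> ones A X = (\<Sum>a\<in>A. of_bool (X a))"
  by (simp add: ones_def of_bool_def sum.If_cases Int_def)

lemma ones_upd:
  assumes "finite A" "x \<in> A"
  shows "ones A (X(x := True)) = ones A (X(x := False)) + 1"
proof -
  have "(\<Sum>a\<in>A - {x}. of_bool ((X(x := True)) a)) = (\<Sum>a\<in>A - {x}. of_bool ((X(x := False)) a) :: real)"
    by (intro sum.cong) auto
  then show ?thesis
    unfolding ones_eq_sum[OF assms(1)] sum.remove[OF assms] by simp
qed

lemma ones_upd_bounds:
  assumes "finite A" "x \<in> A"
  shows "ones A (X(x := False)) \<le> ones A X" "ones A X \<le> ones A (X(x := False)) + 1"
proof -
  have "X = X(x := True) \<or> X = X(x := False)" by (cases "X x") (auto simp: fun_eq_iff)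
  then show "ones A (X(x := False)) \<le> ones A X" "ones A X \<le> ones A (X(x := False)) + 1"
    using ones_upd[OF assms, of X] by auto
qed

text \<open>The Stein identity of the binomial distribution, summed from the single bits. Constant
  \<open>F\<close> gives the mean, \<open>F\<close> the centred count gives the variance, and a
  Stein solution gives the normal approximation.\<close>

lemma ones_integration_by_parts:
  fixes F :: "('a \<Rightarrow> bool) \<Rightarrow> real"
  assumes p: "0 < p" "p < 1" and A: "finite A"
  shows "measure_pmf.expectation (bits A p) (\<lambda>X. (ones A X - real (card A) * p) * F X)
    = p * (1 - p) * (\<Sum>x\<in>A. measure_pmf.expectation (bits A p) (\<lambda>X. F (X(x := True)) - F (X(x := False))))"
proof -
  have "(\<lambda>X. (ones A X - real (card A) * p) * F X) = (\<lambda>X. \<Sum>x\<in>A. (of_bool (X x) - p) * F X)"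
    using A by (simp add: ones_eq_sum sum_subtractf flip: sum_distrib_right)
  then show ?thesis
    using A by (simp add: Bochner_Integration.integral_sum bits_integration_by_parts[OF p A] sum_distrib_left
        cong: sum.cong del: Bochner_Integration.integral_diff)
qed

lemma expectation_ones:
  assumes p: "0 < p" "p < 1" and A: "finite A"
  shows "measure_pmf.expectation (bits A p) (ones A) = real (card A) * p"
  using ones_integration_by_parts[OF assms, of "\<lambda>_. 1"] A by (simp add: measure_pmf.prob_space)

lemma variance_ones:
  assumes p: "0 < p" "p < 1" and A: "finite A"
  shows "measure_pmf.variance (bits A p) (ones A) = real (card A) * p * (1 - p)"
proof -
  have "measure_pmf.variance (bits A p) (ones A)
    = measure_pmf.expectation (bits A p) (\<lambda>X. (ones A X - real (card A) * p) * (ones A X - real (card A) * p))"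
    by (simp add: expectation_ones[OF assms] power2_eq_square)
  also have "\<dots> = p * (1 - p) * (\<Sum>x\<in>A. measure_pmf.expectation (bits A p) (\<lambda>X. 1))"
    unfolding ones_integration_by_parts[OF assms]
    by (intro arg_cong2[of _ _ _ _ "(*)"] refl sum.cong Bochner_Integration.integral_cong)
      (simp_all add: ones_upd[OF A])
  finally show ?thesis by (simp add: measure_pmf.prob_space)
qed

section \<open>The Berry-Esseen bound for the binomial distribution\<close>

abbreviation Phi :: "real \<Rightarrow> real" where
  "Phi \<equiv> cdf std_normal_distribution"

interpretation std_normal: real_distribution std_normal_distribution
  by (rule real_dist_normal_dist)

lemma Phi_bounds: "0 \<le> Phi x" "Phi x \<le> 1"
  using std_normal.cdf_nonneg std_normal.cdf_bounded_prob by auto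

lemma Phi_mono: "x \<le> y \<Longrightarrow> Phi x \<le> Phi y"
  by (rule std_normal.cdf_nondecreasing)

lemma std_normal_density_pos [simp]: "0 < std_normal_density x"
  by (rule normal_density_pos) simp

lemma std_normal_density_nz [simp]: "std_normal_density x \<noteq> 0"
  using std_normal_density_pos[of x] by linarith

lemma std_normal_density_le_1: "std_normal_density x \<le> 1"
proof -
  have "1 \<le> sqrt (2 * pi)" using pi_gt3 by (simp add: real_le_rsqrt)
  then have "1 / sqrt (2 * pi) \<le> 1" by simp
  moreover have "exp (- x\<^sup>2 / 2) \<le> 1" by simp
  ultimately show ?thesis
    unfolding std_normal_density_def using mult_le_one[of "1 / sqrt (2 * pi)" "exp (- x\<^sup>2 / 2)"] by simp
qed

lemma DERIV_std_normal_density: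
  "(std_normal_density has_real_derivative - x * std_normal_density x) (at x)"
proof -
  have "((\<lambda>x. c * exp (- x\<^sup>2 / 2)) has_real_derivative - x * (c * exp (- x\<^sup>2 / 2))) (at x)" for c :: real
    by (auto intro!: derivative_eq_intros simp: power2_eq_square)
  then show ?thesis unfolding std_normal_density_def .
qed

lemma Phi_diff_eq_integral:
  assumes "a \<le> b"
  shows "Phi b - Phi a = integral {a..b} std_normal_density"
proof (cases "a = b")
  case False
  have int: "set_integrable lborel {a<..b} std_normal_density"
    unfolding set_integrable_def by (intro integrable_mult_indicator) auto
  have "Phi b - Phi a = measure std_normal_distribution {a<..b}"
    using std_normal.cdf_diff_eq[of a b] assms False by simp
  also have "\<dots> = (LINT x|std_normal_distribution. indicator {a<..b} x)"
    by simp
  also have "\<dots> = (LINT x:{a<..b}|lborel. std_normal_density x)"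
    by (subst integral_real_density) (auto simp: set_lebesgue_integral_def mult.commute)
  also have "\<dots> = integral {a<..b} std_normal_density"
    by (rule set_borel_integral_eq_integral(2)[OF int])
  also have "\<dots> = integral {a..b} std_normal_density"
    by (rule integral_spike_set) (auto intro: negligible_subset[of "{a}"])
  finally show ?thesis .
qed simp

lemma DERIV_Phi: "(Phi has_real_derivative std_normal_density x) (at x)"
proof -
  have "continuous_on {x - 1..x + 1} std_normal_density"
    by (intro continuous_at_imp_continuous_on ballI DERIV_isCont[OF DERIV_std_normal_density])
  then have "((\<lambda>y. integral {x - 1..y} std_normal_density) has_real_derivative std_normal_density x)
      (at x within {x - 1..x + 1})"
    by (rule integral_has_real_derivative) auto
  then have "((\<lambda>y. Phi (x - 1) + integral {x - 1..y} std_normal_density) has_real_derivative std_normal_density x)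
      (at x within {x - 1..x + 1})"
    by (auto intro!: derivative_eq_intros)
  then have "(Phi has_real_derivative std_normal_density x) (at x within {x - 1..x + 1})"
  proof (rule has_field_derivative_transform_within[where d = 1])
    fix y assume "y \<in> {x - 1..x + 1}"
    then show "Phi (x - 1) + integral {x - 1..y} std_normal_density = Phi y"
      using Phi_diff_eq_integral[of "x - 1" y] by simp
  qed auto
  then show ?thesis
    by (simp add: at_within_interior[of x "{x - 1..x + 1}"])
qed

lemma Phi_mean_value:
  obtains t where "min x y \<le> t" "t \<le> max x y" "\<bar>Phi y - Phi x\<bar> = \<bar>y - x\<bar> * std_normal_density t"
proof (cases x y rule: linorder_cases)
  case less
  then obtain t where "x < t" "t < y" "Phi y - Phi x = (y - x) * std_normal_density t"
    using MVT2[of x y Phi std_normal_density] DERIV_Phi by auto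
  then show ?thesis using that[of t] by (simp add: abs_mult)
next
  case greater
  then obtain t where "y < t" "t < x" "Phi x - Phi y = (x - y) * std_normal_density t"
    using MVT2[of y x Phi std_normal_density] DERIV_Phi by auto
  then show ?thesis using that[of t] by (metis abs_minus_commute abs_mult abs_of_nonneg
        less_eq_real_def max.cobounded1 max.coboundedI1 min.coboundedI2 normal_density_nonneg)
qed (use that in auto)

lemma Phi_lipschitz: "\<bar>Phi y - Phi x\<bar> \<le> \<bar>y - x\<bar>"
proof -
  obtain t where "\<bar>Phi y - Phi x\<bar> = \<bar>y - x\<bar> * std_normal_density t"
    using Phi_mean_value by metis
  then show ?thesis
    using mult_left_mono[OF std_normal_density_le_1, of "\<bar>y - x\<bar>" t] by simp
qed

text \<open>The difference \<open>g\<close> of the two sides, divided by the argument, has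
  derivative -density/x^2 and tends to 0 at infinity; being decreasing, it is positive.\<close>

lemma mills_right:
  assumes "0 < w"
  shows "w * (1 - Phi w) \<le> std_normal_density w"
proof -
  define g where "g x = std_normal_density x / x - (1 - Phi x)" for x
  have "0 < g w"
  proof (rule DERIV_neg_imp_decreasing_at_top[where f = g and b = w])
    show "\<exists>y. (g has_real_derivative y) (at x) \<and> y < 0" if "w \<le> x" for x
    proof -
      have "x > 0" using that assms by simp
      then have "(g has_real_derivative - std_normal_density x / x\<^sup>2) (at x)"
        unfolding g_def
        by (auto intro!: derivative_eq_intros DERIV_std_normal_density DERIV_Phi
            simp: power2_eq_square field_simps)
      moreover have "- std_normal_density x / x\<^sup>2 < 0" using \<open>x > 0\<close> by simp
      ultimately show ?thesis by blast
    qed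
    have "((\<lambda>x. std_normal_density x / x) \<longlongrightarrow> 0) at_top"
      unfolding std_normal_density_def by real_asymp
    then show "(g \<longlongrightarrow> 0) at_top"
      unfolding g_def
      using tendsto_diff[OF _ tendsto_diff[OF tendsto_const[of 1] std_normal.cdf_lim_at_top_prob]] by simp
  qed
  then show ?thesis using assms by (simp add: g_def field_simps)
qed

lemma mills_left:
  assumes "w < 0"
  shows "- w * Phi w \<le> std_normal_density w"
proof -
  define g where "g x = std_normal_density x / (- x) - Phi x" for x
  have "0 < g w"
  proof (rule DERIV_pos_imp_increasing_at_bot[where f = g and b = w])
    show "\<exists>y. (g has_real_derivative y) (at x) \<and> 0 < y" if "x \<le> w" for x
    proof -
      have "x < 0" using that assms by simp
      then have "(g has_real_derivative std_normal_density x / x\<^sup>2) (at x)"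
        unfolding g_def
        by (auto intro!: derivative_eq_intros DERIV_std_normal_density DERIV_Phi
            simp: power2_eq_square field_simps)
      moreover have "0 < std_normal_density x / x\<^sup>2" using \<open>x < 0\<close> by simp
      ultimately show ?thesis by blast
    qed
    have "((\<lambda>x. std_normal_density x / (- x)) \<longlongrightarrow> 0) at_bot"
      unfolding std_normal_density_def by real_asymp
    then show "(g \<longlongrightarrow> 0) at_bot"
      unfolding g_def using tendsto_diff[OF _ std_normal.cdf_lim_at_bot] by simp
  qed
  then show ?thesis using assms by (simp add: g_def field_simps)
qed

text \<open>The bounded solution f of Stein's equation f'(w) - w f(w) = 1[w \<le> z] - \<Phi>(z) in
  closed form; the two branches agree at w = z.\<close>

definition stein :: "real \<Rightarrow> real \<Rightarrow> real" where
  "stein z w = (if w \<le> z then Phi w * (1 - Phi z) else Phi z * (1 - Phi w)) / std_normal_density w"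

lemma stein_left: "w \<le> z \<Longrightarrow> stein z w = Phi w * (1 - Phi z) / std_normal_density w"
  and stein_right: "z \<le> w \<Longrightarrow> stein z w = Phi z * (1 - Phi w) / std_normal_density w"
  by (auto simp: stein_def)

text \<open>In each branch one factor is at most 1, and monotonicity of \<open>Phi\<close> moves the
  other from \<open>z\<close> to \<open>w\<close>. Both Mills ratios are thus upper bounds, and the
  sign of \<open>w\<close> decides which one is useful.\<close>

lemma stein_le_mills:
  "0 \<le> stein z w" "stein z w \<le> Phi w / std_normal_density w" "stein z w \<le> (1 - Phi w) / std_normal_density w"
proof -
  have "0 \<le> (if w \<le> z then Phi w * (1 - Phi z) else Phi z * (1 - Phi w))"
    using Phi_bounds by simp
  then show "0 \<le> stein z w" by (simp add: stein_def)
  have "(if w \<le> z then Phi w * (1 - Phi z) else Phi z * (1 - Phi w)) \<le> Phi w"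
    using Phi_bounds[of w] Phi_bounds[of z] Phi_mono[of z w]
      mult_left_le[of "1 - Phi z" "Phi w"] mult_left_le[of "1 - Phi w" "Phi z"] by auto
  then show "stein z w \<le> Phi w / std_normal_density w"
    unfolding stein_def by (intro divide_right_mono) auto
  have "(if w \<le> z then Phi w * (1 - Phi z) else Phi z * (1 - Phi w)) \<le> 1 - Phi w"
    using Phi_bounds[of w] Phi_bounds[of z] Phi_mono[of w z]
      mult_left_le_one_le[of "1 - Phi z" "Phi w"] mult_left_le_one_le[of "1 - Phi w" "Phi z"] by auto
  then show "stein z w \<le> (1 - Phi w) / std_normal_density w"
    unfolding stein_def by (intro divide_right_mono) auto
qed

lemma abs_mult_stein_le_1: "\<bar>w * stein z w\<bar> \<le> 1"
proof -
  have pos: "0 < std_normal_density w" by simp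
  consider "w = 0" | "0 < w" | "w < 0" by linarith
  then show ?thesis
  proof cases
    case 2
    have "w * stein z w \<le> w * ((1 - Phi w) / std_normal_density w)"
      using 2 stein_le_mills by (intro mult_left_mono) auto
    also have "\<dots> \<le> 1" using mills_right[OF 2] pos by (simp add: divide_le_eq_1)
    finally show ?thesis using 2 stein_le_mills(1) by (simp add: abs_mult)
  next
    case 3
    have "- w * stein z w \<le> - w * (Phi w / std_normal_density w)"
      using 3 stein_le_mills by (intro mult_left_mono) auto
    also have "\<dots> \<le> 1" using mills_left[OF 3] pos by (simp add: field_simps)
    finally show ?thesis using 3 stein_le_mills(1) by (simp add: abs_mult)
  qed simp
qed

text \<open>For \<bar>w\<bar> \<le> 1 the reciprocal density sqrt(2 \<pi>) exp(w^2 / 2) is at most 3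
  * 3; beyond that, the bound on w times the solution already gives 1.\<close>

lemma stein_bounds: "0 \<le> stein z w" "stein z w \<le> 9"
proof -
  show "0 \<le> stein z w" by (rule stein_le_mills)
  show "stein z w \<le> 9"
  proof (cases "\<bar>w\<bar> \<le> 1")
    case True
    have "w\<^sup>2 \<le> 1" using True by (simp add: abs_square_le_1)
    then have "exp (w\<^sup>2 / 2) \<le> exp 1" by simp
    then have e: "exp (w\<^sup>2 / 2) \<le> 3" using exp_le by linarith
    have s: "sqrt (2 * pi) \<le> 3" using pi_less_4 by (intro real_le_lsqrt) auto
    have "stein z w \<le> Phi w / std_normal_density w" by (rule stein_le_mills)
    also have "\<dots> \<le> 1 / std_normal_density w" using Phi_bounds by (intro divide_right_mono) auto
    also have "\<dots> = sqrt (2 * pi) * exp (w\<^sup>2 / 2)" by (simp add: std_normal_density_def exp_minus field_simps)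
    also have "\<dots> \<le> 3 * 3" using e s by (intro mult_mono) auto
    finally show ?thesis by simp
  next
    case False
    then have "1 * stein z w \<le> \<bar>w\<bar> * stein z w"
      using stein_le_mills(1) by (intro mult_right_mono) auto
    also have "\<dots> \<le> 1" using abs_mult_stein_le_1[of w z] stein_le_mills(1)[of z w] by (simp add: abs_mult)
    finally show ?thesis by simp
  qed
qed

text \<open>On either side of the threshold, Stein's equation
  \<open>f'(w) - w f(w) = 1[w \<le> z] - \<Phi>(z)\<close> holds in mean value form.\<close>

lemma stein_mean_value_left:
  assumes "a < b" "b \<le> z"
  obtains t where "a \<le> t" "t \<le> b" "stein z b - stein z a = (b - a) * (t * stein z t + 1 - Phi z)"
proof -
  let ?f = "\<lambda>w. Phi w * (1 - Phi z) / std_normal_density w"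
  have "(?f has_real_derivative w * ?f w + (1 - Phi z)) (at w)" for w
    by (auto intro!: derivative_eq_intros DERIV_std_normal_density DERIV_Phi simp: field_simps)
  then obtain t where t: "a < t" "t < b" "?f b - ?f a = (b - a) * (t * ?f t + (1 - Phi z))"
    using MVT2[OF assms(1), of ?f "\<lambda>w. w * ?f w + (1 - Phi z)"] by blast
  then show ?thesis using that[of t] assms by (simp add: stein_left)
qed

lemma stein_mean_value_right:
  assumes "a < b" "z \<le> a"
  obtains t where "a \<le> t" "t \<le> b" "stein z b - stein z a = (b - a) * (t * stein z t - Phi z)"
proof -
  let ?f = "\<lambda>w. Phi z * (1 - Phi w) / std_normal_density w"
  have "(?f has_real_derivative w * ?f w - Phi z) (at w)" for w
    by (auto intro!: derivative_eq_intros DERIV_std_normal_density DERIV_Phi simp: field_simps)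
  then obtain t where t: "a < t" "t < b" "?f b - ?f a = (b - a) * (t * ?f t - Phi z)"
    using MVT2[OF assms(1), of ?f "\<lambda>w. w * ?f w - Phi z"] by blast
  then show ?thesis using that[of t] assms by (simp add: stein_right)
qed

text \<open>By Stein's equation the slope on either side of \<open>z\<close> is at most 1 + 1 in
  absolute value; an interval across \<open>z\<close> is split there.\<close>

lemma stein_lipschitz: "\<bar>stein z b - stein z a\<bar> \<le> 2 * \<bar>b - a\<bar>"
proof -
  have left: "\<bar>stein z b - stein z a\<bar> \<le> 2 * (b - a)" if ab: "a < b" "b \<le> z" for a b
  proof -
    obtain t where t: "stein z b - stein z a = (b - a) * (t * stein z t + 1 - Phi z)"
      using stein_mean_value_left[OF ab] by metis
    have "\<bar>t * stein z t + 1 - Phi z\<bar> \<le> 2" using abs_mult_stein_le_1[of t z] Phi_bounds[of z] by linarith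
    then have "(b - a) * \<bar>t * stein z t + 1 - Phi z\<bar> \<le> (b - a) * 2" using ab by (intro mult_left_mono) auto
    then show ?thesis unfolding t using ab by (simp add: abs_mult)
  qed
  have right: "\<bar>stein z b - stein z a\<bar> \<le> 2 * (b - a)" if ab: "a < b" "z \<le> a" for a b
  proof -
    obtain t where t: "stein z b - stein z a = (b - a) * (t * stein z t - Phi z)"
      using stein_mean_value_right[OF ab] by metis
    have "\<bar>t * stein z t - Phi z\<bar> \<le> 2" using abs_mult_stein_le_1[of t z] Phi_bounds[of z] by linarith
    then have "(b - a) * \<bar>t * stein z t - Phi z\<bar> \<le> (b - a) * 2" using ab by (intro mult_left_mono) auto
    then show ?thesis unfolding t using ab by (simp add: abs_mult)
  qed
  have le: "\<bar>stein z b - stein z a\<bar> \<le> 2 * (b - a)" if ab: "a \<le> b" for a b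
  proof -
    consider "a = b" | "a < b" "b \<le> z" | "a < b" "z \<le> a" | "a < z" "z < b" using ab by force
    then show ?thesis
    proof cases
      case 4
      then show ?thesis using left[OF 4(1) order_refl] right[OF 4(2) order_refl]
        unfolding abs_le_iff by argo
    qed (use left right in auto)
  qed
  show ?thesis using le[of a b] le[of b a] by (cases "a \<le> b") auto
qed

text \<open>Product rule for differences: 2 is the Lipschitz constant and 9 the bound of the
  solution.\<close>

lemma mult_stein_diff: "\<bar>t * stein z t - w * stein z w\<bar> \<le> (2 * \<bar>w\<bar> + 9) * \<bar>t - w\<bar>"
proof -
  have "t * stein z t - w * stein z w = w * (stein z t - stein z w) + (t - w) * stein z t"
    by (simp add: algebra_simps)
  also have "\<bar>\<dots>\<bar> \<le> \<bar>w\<bar> * \<bar>stein z t - stein z w\<bar> + \<bar>t - w\<bar> * \<bar>stein z t\<bar>"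
    by (rule order_trans[OF abs_triangle_ineq]) (simp add: abs_mult)
  also have "\<dots> \<le> \<bar>w\<bar> * (2 * \<bar>t - w\<bar>) + \<bar>t - w\<bar> * 9"
    using stein_lipschitz[of z t w] stein_bounds[of z t] by (intro add_mono mult_left_mono) auto
  finally show ?thesis by (simp add: algebra_simps)
qed

text \<open>The mean value forms hold at an unknown point; moving it to the given \<open>w\<close>
  costs the last term. If \<open>z\<close> lies inside the interval, the indicator in Stein's
  equation is not constant there: the upper bound takes its larger value, the lower bound its
  smaller one.\<close>

lemma stein_increment:
  assumes ab: "a < b" and w: "a \<le> w" "w \<le> b"
  shows "stein z b - stein z a \<le> (b - a) * (w * stein z w + of_bool (a < z) - Phi z + (2 * \<bar>w\<bar> + 9) * (b - a))"
    and "(b - a) * (w * stein z w + of_bool (b \<le> z) - Phi z - (2 * \<bar>w\<bar> + 9) * (b - a)) \<le> stein z b - stein z a"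
proof -
  define h where "h t = t * stein z t" for t
  define c where "c = (2 * \<bar>w\<bar> + 9) * (b - a)"
  have c0: "0 \<le> c" using ab by (simp add: c_def)
  have h: "h w - c \<le> h t" "h t \<le> h w + c" if "a \<le> t" "t \<le> b" for t
  proof -
    have "\<bar>h t - h w\<bar> \<le> (2 * \<bar>w\<bar> + 9) * \<bar>t - w\<bar>" unfolding h_def by (rule mult_stein_diff)
    also have "\<dots> \<le> c" unfolding c_def using that w by (intro mult_left_mono) auto
    finally show "h w - c \<le> h t" "h t \<le> h w + c" by auto
  qed
  have left: "(y - x) * (h w - c + 1 - Phi z) \<le> stein z y - stein z x \<and>
      stein z y - stein z x \<le> (y - x) * (h w + c + 1 - Phi z)"
    if xy: "a \<le> x" "x < y" "y \<le> b" "y \<le> z" for x y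
  proof -
    obtain t where t: "x \<le> t" "t \<le> y" "stein z y - stein z x = (y - x) * (h t + 1 - Phi z)"
      using stein_mean_value_left[OF xy(2,4)] unfolding h_def by metis
    then show ?thesis unfolding t(3) using h[of t] xy by (intro conjI mult_left_mono) auto
  qed
  have right: "(y - x) * (h w - c - Phi z) \<le> stein z y - stein z x \<and>
      stein z y - stein z x \<le> (y - x) * (h w + c - Phi z)"
    if xy: "a \<le> x" "x < y" "y \<le> b" "z \<le> x" for x y
  proof -
    obtain t where t: "x \<le> t" "t \<le> y" "stein z y - stein z x = (y - x) * (h t - Phi z)"
      using stein_mean_value_right[OF xy(2,4)] unfolding h_def by metis
    then show ?thesis unfolding t(3) using h[of t] xy by (intro conjI mult_left_mono) auto
  qed
  have "stein z b - stein z a \<le> (b - a) * (h w + of_bool (a < z) - Phi z + c)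
    \<and> (b - a) * (h w + of_bool (b \<le> z) - Phi z - c) \<le> stein z b - stein z a"
  proof -
    consider "b \<le> z" | "z \<le> a" | "a < z" "z < b" by linarith
    then show ?thesis
    proof cases
      case 1 then show ?thesis using left[of a b] ab by (auto simp: algebra_simps)
    next
      case 2 then show ?thesis using right[of a b] ab by (auto simp: algebra_simps)
    next
      case 3 then show ?thesis using left[of a z] right[of z b] by (auto simp: algebra_simps)
    qed
  qed
  then show "stein z b - stein z a \<le> (b - a) * (w * stein z w + of_bool (a < z) - Phi z + (2 * \<bar>w\<bar> + 9) * (b - a))"
    and "(b - a) * (w * stein z w + of_bool (b \<le> z) - Phi z - (2 * \<bar>w\<bar> + 9) * (b - a)) \<le> stein z b - stein z a"
    unfolding h_def c_def by auto
qed

section \<open>Stein's method for the number of ones\<close>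

lemma prob_eq_expectation:
  "measure_pmf.prob M {x. Q x} = measure_pmf.expectation M (\<lambda>x. of_bool (Q x))"
proof -
  have "(\<lambda>x. of_bool (Q x) :: real) = indicator {x. Q x}" by (auto simp: fun_eq_iff)
  then show ?thesis by simp
qed

text \<open>Let \<open>W\<close> be the standardized count and \<open>F\<close> the Stein solution
  at \<open>W\<close>. Integration by parts writes E[W F] through increments of \<open>F\<close>
  over steps of length 1/\<sigma>, and \<open>stein_increment\<close> bounds these by Stein's
  equation. What remains compares P(W \<le> z \<plusminus> 1/\<sigma>) with \<Phi>(z), with error (2
  E\<bar>W\<bar> + 9)/\<sigma> \<le> 11/\<sigma>; undoing the shift of \<open>z\<close> costs
  another 1/\<sigma>.\<close>

theorem berry_esseen_bits:
  assumes p: "0 < p" "p < 1" and A: "finite A" "A \<noteq> {}"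
  defines "\<mu> \<equiv> real (card A) * p" and "\<sigma> \<equiv> sqrt (real (card A) * p * (1 - p))"
  shows "\<bar>measure_pmf.prob (bits A p) {X. ones A X \<le> \<mu> + \<sigma> * z} - Phi z\<bar> \<le> 12 / \<sigma>"
proof -
  let ?E = "measure_pmf.expectation (bits A p)"
  have card: "0 < card A" using A by (simp add: card_gt_0_iff)
  have \<sigma>: "0 < \<sigma>" using p card by (simp add: \<sigma>_def)
  have \<sigma>2: "\<sigma> * \<sigma> = real (card A) * p * (1 - p)" using p by (simp add: \<sigma>_def)
  define W where "W X = (ones A X - \<mu>) / \<sigma>" for X
  have absW: "?E (\<lambda>X. \<bar>W X\<bar>) \<le> 1"
  proof -
    have "?E (\<lambda>X. \<bar>W X\<bar>) \<le> ?E (\<lambda>X. (1 + (W X)\<^sup>2) / 2)"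
    proof (intro integral_mono)
      show "\<bar>W X\<bar> \<le> (1 + (W X)\<^sup>2) / 2" for X
        using sum_squares_ge_zero[of "1 - \<bar>W X\<bar>" 0] by (simp add: power2_eq_square algebra_simps)
    qed (use A in auto)
    also have "\<dots> = (1 + ?E (\<lambda>X. (W X)\<^sup>2)) / 2" using A by (simp add: measure_pmf.prob_space)
    also have "?E (\<lambda>X. (W X)\<^sup>2) = ?E (\<lambda>X. (ones A X - \<mu>)\<^sup>2) / \<sigma>\<^sup>2"
      by (simp add: W_def power_divide)
    also have "?E (\<lambda>X. (ones A X - \<mu>)\<^sup>2) = \<sigma>\<^sup>2"
      using variance_ones[OF p A(1)]
      unfolding expectation_ones[OF p A(1)] power2_eq_square[of \<sigma>] \<sigma>2 \<mu>_def .
    finally show ?thesis using \<sigma> by simp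
  qed
  have key: "Phi z - 11 / \<sigma> \<le> measure_pmf.prob (bits A p) {X. W X \<le> z + 1 / \<sigma>}"
    "measure_pmf.prob (bits A p) {X. W X \<le> z - 1 / \<sigma>} \<le> Phi z + 11 / \<sigma>" for z
  proof -
    define F where "F X = stein z (W X)" for X
    define up where "up X = W X * F X + of_bool (W X \<le> z + 1 / \<sigma>) - Phi z + (2 * \<bar>W X\<bar> + 9) / \<sigma>" for X
    define lo where "lo X = W X * F X + of_bool (W X \<le> z - 1 / \<sigma>) - Phi z - (2 * \<bar>W X\<bar> + 9) / \<sigma>" for X
    have diff: "F (X(x := True)) - F (X(x := False)) \<le> up X / \<sigma>"
      "lo X / \<sigma> \<le> F (X(x := True)) - F (X(x := False))" if x: "x \<in> A" for x X
    proof -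
      let ?a = "W (X(x := False))" and ?b = "W (X(x := True))"
      have ab: "?b - ?a = 1 / \<sigma>" using ones_upd[OF A(1) x, of X] by (simp add: W_def diff_divide_distrib[symmetric])
      have w: "?a \<le> W X" "W X \<le> ?b"
        using ones_upd_bounds[OF A(1) x, of X] ones_upd[OF A(1) x, of X] \<sigma>
        by (simp_all add: W_def divide_right_mono)
      have "0 < 1 / \<sigma>" using \<sigma> by simp
      then have lt: "?a < ?b" using ab by linarith
      have "F (X(x := True)) - F (X(x := False)) \<le> (?b - ?a) * (W X * F X + of_bool (?a < z) - Phi z + (2 * \<bar>W X\<bar> + 9) * (?b - ?a))"
        unfolding F_def by (rule stein_increment(1)[OF lt w])
      also have "\<dots> \<le> (?b - ?a) * up X"
      proof (rule mult_left_mono)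
        \<comment> \<open>Since \<open>W X\<close> is at most ?b = ?a + 1/\<sigma>, an indicator at
          ?a is dominated by one at \<open>W X\<close> with shifted threshold.\<close>
        have "of_bool (?a < z) \<le> (of_bool (W X \<le> z + 1 / \<sigma>) :: real)" using w ab by auto
        then show "W X * F X + of_bool (?a < z) - Phi z + (2 * \<bar>W X\<bar> + 9) * (?b - ?a) \<le> up X"
          by (simp add: up_def ab)
      qed (use lt in simp)
      finally show "F (X(x := True)) - F (X(x := False)) \<le> up X / \<sigma>" by (simp add: ab)
      have "(?b - ?a) * lo X \<le> (?b - ?a) * (W X * F X + of_bool (?b \<le> z) - Phi z - (2 * \<bar>W X\<bar> + 9) * (?b - ?a))"
      proof (rule mult_left_mono)
        have "of_bool (W X \<le> z - 1 / \<sigma>) \<le> (of_bool (?b \<le> z) :: real)" using w ab by auto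
        then show "lo X \<le> W X * F X + of_bool (?b \<le> z) - Phi z - (2 * \<bar>W X\<bar> + 9) * (?b - ?a)"
          by (simp add: lo_def ab)
      qed (use lt in simp)
      also have "\<dots> \<le> F (X(x := True)) - F (X(x := False))"
        unfolding F_def by (rule stein_increment(2)[OF lt w])
      finally show "lo X / \<sigma> \<le> F (X(x := True)) - F (X(x := False))" by (simp add: ab)
    qed
    have "\<sigma> * ?E (\<lambda>X. W X * F X) = ?E (\<lambda>X. (ones A X - \<mu>) * F X)"
      unfolding Bochner_Integration.integral_mult_right_zero[symmetric]
      using \<sigma> by (intro Bochner_Integration.integral_cong) (auto simp: W_def)
    also have "\<dots> = p * (1 - p) * (\<Sum>x\<in>A. ?E (\<lambda>X. F (X(x := True)) - F (X(x := False))))"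
      unfolding \<mu>_def by (rule ones_integration_by_parts[OF p A(1)])
    finally have eq: "\<sigma> * ?E (\<lambda>X. W X * F X) = p * (1 - p) * (\<Sum>x\<in>A. ?E (\<lambda>X. F (X(x := True)) - F (X(x := False))))" .
    \<comment> \<open>Summed over \<open>A\<close>, the factor p (1 - p) becomes \<sigma>^2, and the
      step length 1/\<sigma> cancels one \<sigma>.\<close>
    have scale: "p * (1 - p) * (\<Sum>x\<in>A. c / \<sigma>) = \<sigma> * c" for c
    proof -
      have "p * (1 - p) * (\<Sum>x\<in>A. c / \<sigma>) = \<sigma> * \<sigma> * c / \<sigma>" unfolding \<sigma>2 by simp
      then show ?thesis using \<sigma> by simp
    qed
    have "\<sigma> * ?E (\<lambda>X. W X * F X) \<le> p * (1 - p) * (\<Sum>x\<in>A. ?E (\<lambda>X. up X / \<sigma>))"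
      unfolding eq using p A diff(1) by (intro mult_left_mono sum_mono integral_mono) auto
    also have "\<dots> = \<sigma> * ?E up" using scale by simp
    finally have "?E (\<lambda>X. W X * F X) \<le> ?E up" using \<sigma> by simp
    \<comment> \<open>The expectation of \<open>W X * F X\<close> now stands on both sides and
      cancels.\<close>
    also have "?E up = ?E (\<lambda>X. W X * F X) + measure_pmf.prob (bits A p) {X. W X \<le> z + 1 / \<sigma>} - Phi z
        + (2 * ?E (\<lambda>X. \<bar>W X\<bar>) + 9) / \<sigma>"
      unfolding up_def using A by (simp add: prob_eq_expectation measure_pmf.prob_space)
    also have "(2 * ?E (\<lambda>X. \<bar>W X\<bar>) + 9) / \<sigma> \<le> 11 / \<sigma>" using absW \<sigma> by (intro divide_right_mono) auto
    finally show "Phi z - 11 / \<sigma> \<le> measure_pmf.prob (bits A p) {X. W X \<le> z + 1 / \<sigma>}" by simp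
    have "\<sigma> * ?E lo = p * (1 - p) * (\<Sum>x\<in>A. ?E (\<lambda>X. lo X / \<sigma>))" using scale by simp
    also have "\<dots> \<le> \<sigma> * ?E (\<lambda>X. W X * F X)"
      unfolding eq using p A diff(2) by (intro mult_left_mono sum_mono integral_mono) auto
    finally have "?E lo \<le> ?E (\<lambda>X. W X * F X)" using \<sigma> by simp
    moreover have "?E lo = ?E (\<lambda>X. W X * F X) + measure_pmf.prob (bits A p) {X. W X \<le> z - 1 / \<sigma>} - Phi z
        - (2 * ?E (\<lambda>X. \<bar>W X\<bar>) + 9) / \<sigma>"
      unfolding lo_def using A by (simp add: prob_eq_expectation measure_pmf.prob_space)
    moreover have "(2 * ?E (\<lambda>X. \<bar>W X\<bar>) + 9) / \<sigma> \<le> 11 / \<sigma>" using absW \<sigma> by (intro divide_right_mono) auto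
    ultimately show "measure_pmf.prob (bits A p) {X. W X \<le> z - 1 / \<sigma>} \<le> Phi z + 11 / \<sigma>" by simp
  qed
  have "{X. ones A X \<le> \<mu> + \<sigma> * z} = {X. W X \<le> z}" using \<sigma> by (auto simp: W_def field_simps)
  moreover have "Phi (z - 1 / \<sigma>) - 11 / \<sigma> \<le> measure_pmf.prob (bits A p) {X. W X \<le> z}"
    using key(1)[of "z - 1 / \<sigma>"] by simp
  moreover have "measure_pmf.prob (bits A p) {X. W X \<le> z} \<le> Phi (z + 1 / \<sigma>) + 11 / \<sigma>"
    using key(2)[of "z + 1 / \<sigma>"] by simp
  moreover have "\<bar>Phi (z - 1 / \<sigma>) - Phi z\<bar> \<le> 1 / \<sigma>" "\<bar>Phi (z + 1 / \<sigma>) - Phi z\<bar> \<le> 1 / \<sigma>"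
    using Phi_lipschitz[of "z - 1 / \<sigma>" z] Phi_lipschitz[of "z + 1 / \<sigma>" z] \<sigma> by auto
  ultimately show ?thesis by (simp add: abs_le_iff)
qed

text \<open>The decay of the density absorbs the quadratic factor: (1 + t^2) times the density is at
  most 2, and \<bar>z - t\<bar> \<le> 10 gives 1 + z^2 \<le> 201 (1 + t^2), whence 402 = 201 *
  2.\<close>

lemma Phi_diff_le_quadratic:
  assumes k: "\<bar>y - z\<bar> \<le> k * (1 + z\<^sup>2)" and "\<bar>y - z\<bar> \<le> 10"
  shows "\<bar>Phi y - Phi z\<bar> \<le> 402 * k"
proof -
  obtain t where t: "min z y \<le> t" "t \<le> max z y" "\<bar>Phi y - Phi z\<bar> = \<bar>y - z\<bar> * std_normal_density t"
    using Phi_mean_value by metis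
  have k0: "0 \<le> k" using k zero_le_power2[of z] abs_ge_zero[of "y - z"]
    by (smt (verit) mult_neg_pos)
  have "\<bar>z - t\<bar> \<le> 10" using t assms by auto
  then have "(z - t)\<^sup>2 \<le> 100" using abs_le_square_iff[of "z - t" 10] by simp
  moreover have "z\<^sup>2 \<le> 2 * t\<^sup>2 + 2 * (z - t)\<^sup>2"
    using zero_le_power2[of "2 * t - z"] by (simp add: power2_eq_square algebra_simps)
  moreover have "0 \<le> t\<^sup>2" by simp
  ultimately have z2: "1 + z\<^sup>2 \<le> 201 * (1 + t\<^sup>2)" by argo
  have "1 + t\<^sup>2 / 2 \<le> exp (t\<^sup>2 / 2)" by (rule exp_ge_add_one_self)
  then have "(1 + t\<^sup>2) * exp (- t\<^sup>2 / 2) \<le> 2"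
    by (simp add: exp_minus field_simps)
  moreover have "std_normal_density t \<le> exp (- t\<^sup>2 / 2)"
  proof -
    have "1 \<le> sqrt (2 * pi)" using pi_gt3 by (simp add: real_le_rsqrt)
    then show ?thesis unfolding std_normal_density_def
      using mult_right_mono[of "1 / sqrt (2 * pi)" 1 "exp (- t\<^sup>2 / 2)"] by simp
  qed
  then have "(1 + t\<^sup>2) * std_normal_density t \<le> (1 + t\<^sup>2) * exp (- t\<^sup>2 / 2)"
    by (intro mult_left_mono) auto
  ultimately have dens: "(1 + t\<^sup>2) * std_normal_density t \<le> 2" by linarith
  have "\<bar>Phi y - Phi z\<bar> \<le> k * (1 + z\<^sup>2) * std_normal_density t"
    unfolding t(3) using k by (intro mult_right_mono) auto
  also have "\<dots> \<le> k * (201 * (1 + t\<^sup>2)) * std_normal_density t"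
    using k0 z2 by (intro mult_right_mono mult_left_mono) auto
  also have "\<dots> = 201 * k * ((1 + t\<^sup>2) * std_normal_density t)" by simp
  also have "\<dots> \<le> 201 * k * 2" using k0 dens by (intro mult_left_mono) auto
  finally show ?thesis by simp
qed

text \<open>The density is at most 1/t^2, and the Mills bounds pass this on to the tails. This rate
  matches Chebyshev's inequality, with which it is combined.\<close>

lemma Phi_tails:
  assumes "1 \<le> t"
  shows "Phi (- t) \<le> 1 / t\<^sup>2" "1 - Phi t \<le> 1 / t\<^sup>2"
proof -
  have "1 + t\<^sup>2 / 2 \<le> exp (t\<^sup>2 / 2)" by (rule exp_ge_add_one_self)
  then have e: "exp (- t\<^sup>2 / 2) \<le> 2 / t\<^sup>2"
    using assms by (simp add: exp_minus field_simps)
  have "2 \<le> sqrt (2 * pi)" using pi_gt3 by (intro real_le_rsqrt) auto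
  then have "1 / sqrt (2 * pi) \<le> 1 / 2" by (intro divide_left_mono) auto
  then have "1 / sqrt (2 * pi) * exp (- t\<^sup>2 / 2) \<le> 1 / 2 * (2 / t\<^sup>2)"
    using e by (intro mult_mono) auto
  then have d: "std_normal_density t \<le> 1 / t\<^sup>2" by (simp add: std_normal_density_def)
  have "1 * Phi (- t) \<le> t * Phi (- t)" using assms Phi_bounds by (intro mult_right_mono) auto
  also have "\<dots> \<le> std_normal_density (- t)" using mills_left[of "- t"] assms by simp
  also have "\<dots> \<le> 1 / t\<^sup>2" using d by (simp add: std_normal_density_def)
  finally show "Phi (- t) \<le> 1 / t\<^sup>2" by simp
  have "1 * (1 - Phi t) \<le> t * (1 - Phi t)" using assms Phi_bounds by (intro mult_right_mono) auto
  also have "\<dots> \<le> std_normal_density t" using mills_right[of t] assms by simp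
  finally show "1 - Phi t \<le> 1 / t\<^sup>2" using d by simp
qed

section \<open>Quadratic functionals of the number of ones\<close>

abbreviation sd :: "'a pmf \<Rightarrow> ('a \<Rightarrow> real) \<Rightarrow> real" where
  "sd M F \<equiv> sqrt (measure_pmf.variance M F)"

text \<open>As a weighted Euclidean norm, the standard deviation inherits the triangle
  inequality.\<close>

lemma sd_eq_L2_set:
  assumes "finite (set_pmf M)"
  shows "sd M F = L2_set (\<lambda>x. sqrt (pmf M x) * (F x - measure_pmf.expectation M F)) (set_pmf M)"
proof -
  have "measure_pmf.variance M F
      = (\<Sum>x\<in>set_pmf M. (F x - measure_pmf.expectation M F)\<^sup>2 * pmf M x)"
    by (rule integral_measure_pmf_real[OF assms]) auto
  then show ?thesis by (simp add: L2_set_def power_mult_distrib mult.commute)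
qed

lemma sd_add_le:
  assumes "finite (set_pmf M)"
  shows "sd M (\<lambda>x. F x + G x) \<le> sd M F + sd M G"
proof -
  have "measure_pmf.expectation M (\<lambda>x. F x + G x) = measure_pmf.expectation M F + measure_pmf.expectation M G"
    using assms by (simp add: integrable_measure_pmf_finite)
  then have "sd M (\<lambda>x. F x + G x) = L2_set (\<lambda>x. sqrt (pmf M x) * (F x - measure_pmf.expectation M F)
      + sqrt (pmf M x) * (G x - measure_pmf.expectation M G)) (set_pmf M)"
    unfolding sd_eq_L2_set[OF assms] by (simp add: algebra_simps)
  also have "\<dots> \<le> sd M F + sd M G"
    unfolding sd_eq_L2_set[OF assms] by (rule L2_set_triangle_ineq)
  finally show ?thesis .
qed

lemma sd_scale:
  "sd M (\<lambda>x. c * F x) = \<bar>c\<bar> * sd M F"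
proof -
  have "measure_pmf.variance M (\<lambda>x. c * F x) = c\<^sup>2 * measure_pmf.variance M F"
    by (simp add: power_mult_distrib flip: right_diff_distrib)
  then show ?thesis by (simp add: real_sqrt_mult)
qed

lemma sd_diff_le:
  assumes "finite (set_pmf M)"
  shows "\<bar>sd M F - sd M G\<bar> \<le> sd M (\<lambda>x. F x - G x)"
proof -
  have "sd M F \<le> sd M G + sd M (\<lambda>x. F x - G x)"
    using sd_add_le[OF assms, of G "\<lambda>x. F x - G x"] by simp
  moreover have "sd M G \<le> sd M F + sd M (\<lambda>x. -1 * (F x - G x))"
    using sd_add_le[OF assms, of F "\<lambda>x. -1 * (F x - G x)"] by simp
  ultimately show ?thesis unfolding sd_scale by (simp add: abs_le_iff)
qed

text \<open>The factorisation shows that 9/2 x^2 - c x increases wherever the second factor is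
  positive; used with c = 7/2 and c = 3/2, the two extremes for the correction
  \<open>B\<close>.\<close>

lemma quadratic_diff:
  "(a - b) * (9 / 2 * (b + a) - c) = (9 / 2 * a\<^sup>2 - c * a) - (9 / 2 * b\<^sup>2 - c * (b::real))"
  by (simp add: power2_eq_square field_simps)

text \<open>The edge count abstracted to a function of independent bits: \<open>A\<close> stands for
  the possible arcs and \<open>B\<close> for the number of pairs of vertices that span no edge. Only
  the size and the increments of \<open>B\<close> enter the estimates.\<close>

locale quadratic_functional =
  fixes A :: "'a set" and p :: real and B K :: "('a \<Rightarrow> bool) \<Rightarrow> real"
  assumes finite_A: "finite A" and nonempty_A: "A \<noteq> {}" and p: "0 < p" "p < 1"
    and B: "0 \<le> B X" "B X \<le> 2 * ones A X"
    and B_diff: "x \<in> A \<Longrightarrow> 0 \<le> B (X(x := True)) - B (X(x := False))"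
      "x \<in> A \<Longrightarrow> B (X(x := True)) - B (X(x := False)) \<le> 4"
    and K: "K X = 9 / 2 * (ones A X)\<^sup>2 - 3 / 2 * ones A X - B X"
begin

abbreviation "M \<equiv> bits A p"
abbreviation "expect \<equiv> measure_pmf.expectation M"
abbreviation "m \<equiv> ones A"

definition "\<mu> = real (card A) * p"
definition "\<sigma> = sqrt (real (card A) * p * (1 - p))"

lemma finite_set_M: "finite (set_pmf M)"
  by (rule finite_set_bits[OF finite_A])

lemma card_pos: "0 < card A"
  using finite_A nonempty_A by (simp add: card_gt_0_iff)

lemma \<mu>_pos: "0 < \<mu>" and \<sigma>_pos: "0 < \<sigma>"
  using card_pos p by (auto simp: \<mu>_def \<sigma>_def)

lemma \<sigma>2: "\<sigma>\<^sup>2 = real (card A) * p * (1 - p)"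
  using p by (simp add: \<sigma>_def)

lemma \<sigma>2_le: "\<sigma>\<^sup>2 \<le> \<mu>"
  unfolding \<sigma>2 \<mu>_def using p by (simp add: mult_left_le)

lemma expect_m: "expect m = \<mu>"
  using expectation_ones[OF p finite_A] by (simp add: \<mu>_def)

lemma variance_m: "expect (\<lambda>X. (m X - \<mu>)\<^sup>2) = \<sigma>\<^sup>2"
  using variance_ones[OF p finite_A] unfolding expect_m \<sigma>2 .

text \<open>The second moment of \<open>m\<close> is \<sigma>^2 + \<mu>^2, where 0 \<le> \<sigma>^2
  \<le> \<mu>, and the mean of \<open>B\<close> lies between 0 and 2 \<mu>.\<close>

lemma expect_K_bounds:
  "9 / 2 * \<mu>\<^sup>2 - 7 / 2 * \<mu> \<le> expect K" "expect K \<le> 9 / 2 * \<mu>\<^sup>2 + 9 / 2 * \<mu>"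
proof -
  have "expect (\<lambda>X. (m X - 0)\<^sup>2) = \<sigma>\<^sup>2 + \<mu>\<^sup>2"
    using expectation_square_diff[OF finite_set_M, of m 0] unfolding expect_m variance_m by simp
  then have m2: "expect (\<lambda>X. (m X)\<^sup>2) = \<sigma>\<^sup>2 + \<mu>\<^sup>2" by simp
  have "K = (\<lambda>X. 9 / 2 * (m X)\<^sup>2 - 3 / 2 * m X - B X)" by (rule ext) (rule K)
  then have eq: "expect K = 9 / 2 * (\<sigma>\<^sup>2 + \<mu>\<^sup>2) - 3 / 2 * \<mu> - expect B"
    using finite_A by (simp add: m2 expect_m)
  have "expect (\<lambda>X. 0) \<le> expect B"
    using B finite_A by (intro integral_mono) auto
  then have B0: "0 \<le> expect B" by simp
  have "expect B \<le> expect (\<lambda>X. 2 * m X)"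
    using B finite_A by (intro integral_mono) auto
  then have "expect B \<le> 2 * \<mu>" by (simp add: expect_m)
  moreover have "0 \<le> \<sigma>\<^sup>2" by simp
  ultimately show "9 / 2 * \<mu>\<^sup>2 - 7 / 2 * \<mu> \<le> expect K" "expect K \<le> 9 / 2 * \<mu>\<^sup>2 + 9 / 2 * \<mu>"
    unfolding eq using B0 \<sigma>2_le \<mu>_pos by argo+
qed

text \<open>Flipping an arc changes \<open>K\<close> by 9 m' + 3 - b. Subtracting the linear part 9
  \<mu> m turns this into 9 (m' - \<mu>) + 3 - b, of the order of the fluctuation of
  \<open>m\<close> rather than its mean.\<close>

lemma remainder_diff_bound:
  assumes x: "x \<in> A"
  shows "((K (X(x := True)) - 9 * \<mu> * m (X(x := True))) - (K (X(x := False)) - 9 * \<mu> * m (X(x := False))))\<^sup>2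
    \<le> 162 * (m X - \<mu>)\<^sup>2 + 288"
proof -
  define m' where "m' = m (X(x := False))"
  define b where "b = B (X(x := True)) - B (X(x := False))"
  define D where "D = (K (X(x := True)) - 9 * \<mu> * m (X(x := True))) - (K (X(x := False)) - 9 * \<mu> * m (X(x := False)))"
  have "D = 9 * (m' - \<mu>) + 3 - b"
    unfolding D_def b_def K ones_upd[OF finite_A x] m'_def[symmetric] by (simp add: power2_eq_square field_simps)
  moreover have "0 \<le> b" "b \<le> 4" using B_diff[OF x] by (auto simp: b_def)
  moreover have "m' \<le> m X" "m X \<le> m' + 1" using ones_upd_bounds[OF finite_A x] by (auto simp: m'_def)
  ultimately have "\<bar>D\<bar> \<le> 9 * \<bar>m X - \<mu>\<bar> + 12" by (simp add: abs_le_iff abs_real_def)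
  then have "\<bar>D\<bar>\<^sup>2 \<le> (9 * \<bar>m X - \<mu>\<bar> + 12)\<^sup>2" by (rule power_mono) simp
  then have "D\<^sup>2 \<le> (9 * \<bar>m X - \<mu>\<bar> + 12)\<^sup>2" by simp
  also have "\<dots> \<le> 162 * (m X - \<mu>)\<^sup>2 + 288"
    using zero_le_power2[of "9 * \<bar>m X - \<mu>\<bar> - 12"] by (simp add: power2_eq_square algebra_simps)
  finally show ?thesis unfolding D_def .
qed

text \<open>The linear part has standard deviation exactly 9 \<mu> \<sigma>; Efron-Stein bounds that
  of the remainder, and the reverse triangle inequality combines the two.\<close>

lemma sd_K:
  assumes "1 \<le> \<mu>"
  shows "\<bar>sd M K - 9 * \<mu> * \<sigma>\<bar> \<le> 22 * \<sigma> * sqrt \<mu>"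
proof -
  let ?R = "\<lambda>X. K X - 9 * \<mu> * m X"
  have "measure_pmf.variance M ?R \<le> p * (1 - p) *
      (\<Sum>x\<in>A. expect (\<lambda>X. (?R (X(x := True)) - ?R (X(x := False)))\<^sup>2))"
    by (rule efron_stein_bits[OF p finite_A])
  also have "\<dots> \<le> p * (1 - p) * (\<Sum>x\<in>A. expect (\<lambda>X. 162 * (m X - \<mu>)\<^sup>2 + 288))"
    using p finite_A by (intro mult_left_mono sum_mono integral_mono remainder_diff_bound) auto
  also have "expect (\<lambda>X. 162 * (m X - \<mu>)\<^sup>2 + 288) = 162 * \<sigma>\<^sup>2 + 288"
    using finite_A by (simp add: variance_m measure_pmf.prob_space)
  also have "p * (1 - p) * (\<Sum>x\<in>A. 162 * \<sigma>\<^sup>2 + 288) = \<sigma>\<^sup>2 * (162 * \<sigma>\<^sup>2 + 288)"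
    unfolding \<sigma>2 by simp
  \<comment> \<open>Since \<mu> \<ge> 1, the bracket is at most (162 + 288) \<mu> = 450 \<mu>; 484 =
    22^2 is a square above 450.\<close>
  also have "\<dots> \<le> \<sigma>\<^sup>2 * (484 * \<mu>)"
    using \<sigma>2_le assms by (intro mult_left_mono) auto
  also have "\<dots> = (22 * \<sigma> * sqrt \<mu>)\<^sup>2"
    using \<mu>_pos by (simp add: power_mult_distrib)
  finally have "sd M ?R \<le> sqrt ((22 * \<sigma> * sqrt \<mu>)\<^sup>2)"
    by (rule real_sqrt_le_mono)
  also have "\<dots> = 22 * \<sigma> * sqrt \<mu>" using \<sigma>_pos \<mu>_pos by simp
  finally have "sd M ?R \<le> 22 * \<sigma> * sqrt \<mu>" .
  moreover have "sd M (\<lambda>X. 9 * \<mu> * m X) = 9 * \<mu> * \<sigma>"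
    unfolding sd_scale expect_m variance_m using \<mu>_pos \<sigma>_pos by simp
  ultimately show ?thesis
    using sd_diff_le[OF finite_set_M, of K "\<lambda>X. 9 * \<mu> * m X"] by simp
qed

section \<open>Normal approximation for large \<sigma>\<close>

context
  assumes \<sigma>_large: "100 \<le> \<sigma>"
begin

lemma \<sigma>_\<mu>: "100 * \<sigma> \<le> \<mu>" "10000 \<le> \<mu>" "\<sigma> * sqrt \<mu> \<le> \<mu>"
proof -
  have "100 * \<sigma> \<le> \<sigma> * \<sigma>" using \<sigma>_large by (intro mult_right_mono) auto
  then show "100 * \<sigma> \<le> \<mu>" using \<sigma>2_le by (simp add: power2_eq_square)
  then show "10000 \<le> \<mu>" using \<sigma>_large by simp
  have "\<sigma> \<le> sqrt \<mu>" using \<sigma>2_le by (rule real_le_rsqrt)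
  then have "\<sigma> * sqrt \<mu> \<le> sqrt \<mu> * sqrt \<mu>" using \<mu>_pos by (intro mult_right_mono) auto
  then show "\<sigma> * sqrt \<mu> \<le> \<mu>" using \<mu>_pos by simp
qed

lemma sd_K_large: "\<bar>sd M K - 9 * \<mu> * \<sigma>\<bar> \<le> 22 * \<mu>" "0 < sd M K"
proof -
  show 1: "\<bar>sd M K - 9 * \<mu> * \<sigma>\<bar> \<le> 22 * \<mu>"
    using sd_K \<sigma>_\<mu> by linarith
  have "9 * \<mu> * 100 \<le> 9 * \<mu> * \<sigma>" using \<sigma>_large \<mu>_pos by (intro mult_left_mono) auto
  then show "0 < sd M K" using 1 \<mu>_pos by linarith
qed

text \<open>By 2 \<bar>z\<bar> \<le> 1 + z^2 the error in the standard deviation takes the quadratic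
  form that \<open>Phi_diff_le_quadratic\<close> can absorb.\<close>

lemma z_sd_K: "\<bar>z * sd M K - 9 * \<mu> * \<sigma> * z\<bar> \<le> 11 * (\<mu> * (1 + z\<^sup>2))"
proof -
  have "\<bar>z * sd M K - 9 * \<mu> * \<sigma> * z\<bar> = \<bar>z\<bar> * \<bar>sd M K - 9 * \<mu> * \<sigma>\<bar>"
    by (simp add: algebra_simps flip: abs_mult)
  also have "\<dots> \<le> \<bar>z\<bar> * (22 * \<mu>)" by (intro mult_left_mono sd_K_large) auto
  also have "\<dots> = 11 * \<mu> * (2 * \<bar>z\<bar>)" by simp
  also have "\<dots> \<le> 11 * \<mu> * (1 + z\<^sup>2)"
    using \<mu>_pos zero_le_power2[of "1 - \<bar>z\<bar>"]
    by (intro mult_left_mono) (auto simp: power2_eq_square algebra_simps)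
  finally show ?thesis by simp
qed

context
  fixes z :: real
  assumes z: "\<bar>z\<bar> \<le> sqrt \<sigma>"
begin

lemma z2: "z\<^sup>2 \<le> \<sigma>"
  using z by (metis abs_ge_zero abs_le_square_iff abs_of_nonneg order_trans real_sqrt_pow2 real_sqrt_ge_0_iff)

lemma \<sigma>_z: "\<sigma> * \<bar>z\<bar> \<le> \<mu> / 10"
proof -
  have "sqrt \<sigma> * 10 \<le> sqrt \<sigma> * sqrt \<sigma>"
    using \<sigma>_large by (intro mult_left_mono real_le_rsqrt) auto
  then have "sqrt \<sigma> \<le> \<sigma> / 10" using \<sigma>_pos by simp
  then have "\<sigma> * \<bar>z\<bar> \<le> \<sigma> * (\<sigma> / 10)" using z \<sigma>_pos by (intro mult_left_mono) auto
  then show ?thesis using \<sigma>2_le by (simp add: power2_eq_square)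
qed

text \<open>Otherwise monotonicity of 9/2 x^2 - 7/2 x, a lower bound for \<open>K\<close> because B
  \<le> 2 m, forces \<open>K X\<close> above the threshold. The shift 5 (1 + z^2) of
  \<open>m\<close> raises the quadratic by 45 u, which outweighs the 11 u from the standard
  deviation and the errors of order \<mu>.\<close>

lemma K_le_imp:
  assumes le: "K X \<le> expect K + z * sd M K"
  shows "m X \<le> \<mu> + \<sigma> * (z + 5 * (1 + z\<^sup>2) / \<sigma>)"
proof (rule ccontr)
  define d where "d = \<sigma> * z + 5 * (1 + z\<^sup>2)"
  define u where "u = \<mu> * (1 + z\<^sup>2)"
  have d_eq: "\<sigma> * (z + 5 * (1 + z\<^sup>2) / \<sigma>) = d" using \<sigma>_pos by (simp add: d_def field_simps)
  assume "\<not> m X \<le> \<mu> + \<sigma> * (z + 5 * (1 + z\<^sup>2) / \<sigma>)"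
  then have gt: "\<mu> + d < m X" unfolding d_eq by simp
  have "\<bar>\<sigma> * z\<bar> \<le> \<mu> / 10" using \<sigma>_z \<sigma>_pos by (simp add: abs_mult)
  then have sz: "\<sigma> * z \<le> \<mu> / 10" "- (\<mu> / 10) \<le> \<sigma> * z" by linarith+
  have z0: "0 \<le> z\<^sup>2" by simp
  \<comment> \<open>Makes the second factor of the product below positive.\<close>
  have a1: "1 \<le> \<mu> + d" using sz \<sigma>_\<mu>(1,2) z0 unfolding d_def by argo
  have u: "\<mu> \<le> u" "10000 * (1 + z\<^sup>2) \<le> u"
    using \<mu>_pos \<sigma>_\<mu> z0 mult_right_mono[OF \<sigma>_\<mu>(2), of "1 + z\<^sup>2"] by (auto simp: u_def algebra_simps)
  have "0 < (m X - (\<mu> + d)) * (9 / 2 * ((\<mu> + d) + m X) - 7 / 2)"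
    using gt a1 by (intro mult_pos_pos) auto
  then have "9 / 2 * (\<mu> + d)\<^sup>2 - 7 / 2 * (\<mu> + d) < 9 / 2 * (m X)\<^sup>2 - 7 / 2 * m X"
    unfolding quadratic_diff by linarith
  also have "\<dots> \<le> expect K + z * sd M K"
    using le B(2)[of X] unfolding K by simp
  also have "\<dots> \<le> 9 / 2 * \<mu>\<^sup>2 + 9 / 2 * \<mu> + (9 * \<mu> * \<sigma> * z + 11 * u)"
    using expect_K_bounds(2) z_sd_K[of z] unfolding u_def by linarith
  finally have "9 / 2 * (\<mu> + d)\<^sup>2 - 7 / 2 * (\<mu> + d) < 9 / 2 * \<mu>\<^sup>2 + 9 / 2 * \<mu> + 9 * \<mu> * \<sigma> * z + 11 * u" by simp
  moreover have "9 / 2 * (\<mu> + d)\<^sup>2 = 9 / 2 * \<mu>\<^sup>2 + 9 * \<mu> * \<sigma> * z + 45 * u + 9 / 2 * d\<^sup>2"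
    by (simp add: u_def d_def power2_eq_square algebra_simps)
  moreover have "0 \<le> d\<^sup>2" by simp
  moreover have "d \<le> \<mu> / 10 + 5 * (1 + z\<^sup>2)" using sz by (simp add: d_def)
  ultimately show False using u \<mu>_pos by argo
qed

text \<open>The reverse comparison uses B \<ge> 0. Here the square of the shift \<open>d\<close>
  works against the claim and has to be bounded.\<close>

lemma K_leI:
  assumes le: "m X \<le> \<mu> + \<sigma> * (z - 5 * (1 + z\<^sup>2) / \<sigma>)"
  shows "K X \<le> expect K + z * sd M K"
proof -
  define d where "d = \<sigma> * z - 5 * (1 + z\<^sup>2)"
  define u where "u = \<mu> * (1 + z\<^sup>2)"
  have d_eq: "\<sigma> * (z - 5 * (1 + z\<^sup>2) / \<sigma>) = d" using \<sigma>_pos by (simp add: d_def field_simps)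
  have ma: "m X \<le> \<mu> + d" using le unfolding d_eq .
  have "\<bar>\<sigma> * z\<bar> \<le> \<mu> / 10" using \<sigma>_z \<sigma>_pos by (simp add: abs_mult)
  then have sz: "\<sigma> * z \<le> \<mu> / 10" "- (\<mu> / 10) \<le> \<sigma> * z" by linarith+
  have z0: "0 \<le> z\<^sup>2" by simp
  have a1: "1 \<le> \<mu> + d" using sz \<sigma>_\<mu>(1,2) z2 unfolding d_def by argo
  have u: "\<mu> \<le> u" using \<mu>_pos z0 by (simp add: u_def algebra_simps)
  have "0 \<le> (\<mu> + d - m X) * (9 / 2 * (m X + (\<mu> + d)) - 3 / 2)"
    using ma a1 by (intro mult_nonneg_nonneg) (auto simp: ones_def)
  then have "9 / 2 * (m X)\<^sup>2 - 3 / 2 * m X \<le> 9 / 2 * (\<mu> + d)\<^sup>2 - 3 / 2 * (\<mu> + d)"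
    unfolding quadratic_diff by linarith
  then have "K X \<le> 9 / 2 * (\<mu> + d)\<^sup>2"
    using B(1)[of X] a1 unfolding K by argo
  also have "\<dots> = 9 / 2 * \<mu>\<^sup>2 + 9 * \<mu> * \<sigma> * z - 45 * u + 9 / 2 * d\<^sup>2"
    by (simp add: u_def d_def power2_eq_square algebra_simps)
  \<comment> \<open>This uses z^2 \<le> \<sigma>, by which 50 (1 + z^2) \<le> \<mu>. Of the gain 45
    u it costs 27/2 u.\<close>
  also have "d\<^sup>2 \<le> 3 * u"
  proof -
    have "d\<^sup>2 \<le> 2 * (\<sigma>\<^sup>2 * z\<^sup>2) + 2 * (5 * (1 + z\<^sup>2))\<^sup>2"
      using zero_le_power2[of "\<sigma> * z + 5 * (1 + z\<^sup>2)"] by (simp add: d_def power2_eq_square algebra_simps)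
    also have "\<sigma>\<^sup>2 * z\<^sup>2 \<le> \<mu> * z\<^sup>2" using \<sigma>2_le by (intro mult_right_mono) auto
    also have "2 * (5 * (1 + z\<^sup>2))\<^sup>2 = (50 * (1 + z\<^sup>2)) * (1 + z\<^sup>2)" by (simp add: power2_eq_square algebra_simps)
    also have "\<dots> \<le> \<mu> * (1 + z\<^sup>2)"
      using z2 z0 \<sigma>_\<mu> \<sigma>_large by (intro mult_right_mono) auto
    finally have "d\<^sup>2 \<le> 2 * (\<mu> * z\<^sup>2) + \<mu> * (1 + z\<^sup>2)" by simp
    then show ?thesis using \<mu>_pos z0 unfolding u_def by (simp add: algebra_simps)
  qed
  finally have "K X \<le> 9 / 2 * \<mu>\<^sup>2 + 9 * \<mu> * \<sigma> * z - 31 * u" using u \<mu>_pos by simp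
  also have "\<dots> \<le> expect K + z * sd M K"
    using expect_K_bounds(1) z_sd_K[of z] u \<mu>_pos unfolding u_def[symmetric] by linarith
  finally show ?thesis .
qed

text \<open>The event lies between two events for \<open>m\<close> with thresholds z - e and z + e.
  Berry-Esseen costs 12/\<sigma> and the shift by \<open>e\<close> costs 402 * 5/\<sigma>, together
  2022/\<sigma>.\<close>

lemma normal_approximation_central:
  "\<bar>measure_pmf.prob M {X. K X \<le> expect K + z * sd M K} - Phi z\<bar> \<le> 2022 / \<sigma>"
proof -
  let ?P = "\<lambda>y. measure_pmf.prob M {X. m X \<le> \<mu> + \<sigma> * y}"
  define e where "e = 5 * (1 + z\<^sup>2) / \<sigma>"
  have be: "\<bar>?P y - Phi y\<bar> \<le> 12 / \<sigma>" for y
    unfolding \<mu>_def \<sigma>_def by (rule berry_esseen_bits[OF p finite_A nonempty_A])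
  \<comment> \<open>Because 1 + z^2 \<le> 1 + \<sigma> \<le> 2 \<sigma>; this provides the bound 10
    required by \<open>Phi_diff_le_quadratic\<close>.\<close>
  have "e \<le> 5 * (2 * \<sigma>) / \<sigma>"
    unfolding e_def using z2 \<sigma>_large by (intro divide_right_mono mult_left_mono) auto
  then have e: "0 \<le> e" "e \<le> 10" using \<sigma>_pos by (auto simp: e_def)
  have phi: "\<bar>Phi y - Phi z\<bar> \<le> 402 * (5 / \<sigma>)" if "\<bar>y - z\<bar> = e" for y
    using that e(2) by (intro Phi_diff_le_quadratic) (auto simp: e_def)
  have "\<bar>Phi (z + e) - Phi z\<bar> \<le> 402 * (5 / \<sigma>)" "\<bar>Phi (z - e) - Phi z\<bar> \<le> 402 * (5 / \<sigma>)"
    using e(1) by (intro phi, simp)+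
  moreover have "measure_pmf.prob M {X. K X \<le> expect K + z * sd M K} \<le> ?P (z + e)"
    using K_le_imp unfolding e_def by (intro measure_pmf.finite_measure_mono) auto
  moreover have "?P (z - e) \<le> measure_pmf.prob M {X. K X \<le> expect K + z * sd M K}"
    using K_leI unfolding e_def by (intro measure_pmf.finite_measure_mono) auto
  moreover have "12 / \<sigma> + 402 * (5 / \<sigma>) = 2022 / \<sigma>" by (simp flip: add_divide_distrib)
  ultimately show ?thesis
    using be[of "z + e"] be[of "z - e"] unfolding abs_le_iff by linarith
qed

end

text \<open>Chebyshev's inequality and the normal tail bound place both probabilities within 1/z^2
  \<le> 1/\<sigma> of 1 or of 0, according to the sign of \<open>z\<close>.\<close>

lemma normal_approximation_tail:
  assumes z: "sqrt \<sigma> \<le> \<bar>z\<bar>"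
  shows "\<bar>measure_pmf.prob M {X. K X \<le> expect K + z * sd M K} - Phi z\<bar> \<le> 2022 / \<sigma>"
proof -
  let ?P = "measure_pmf.prob M {X. K X \<le> expect K + z * sd M K}"
  have s0: "0 < sd M K" by (rule sd_K_large)
  have "1 \<le> sqrt \<sigma>" using \<sigma>_large by simp
  then have z1: "1 \<le> \<bar>z\<bar>" using z by linarith
  have "(sqrt \<sigma>)\<^sup>2 \<le> \<bar>z\<bar>\<^sup>2" using z \<sigma>_pos by (intro power_mono) auto
  moreover have "0 < z\<^sup>2" using z1 by auto
  ultimately have z2: "1 / z\<^sup>2 \<le> 1 / \<sigma>" using \<sigma>_pos by (intro divide_left_mono) auto
  have "measure_pmf.prob M {X \<in> space M. \<bar>z\<bar> * sd M K \<le> \<bar>K X - expect K\<bar>}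
      \<le> measure_pmf.variance M K / (\<bar>z\<bar> * sd M K)\<^sup>2"
    using finite_A s0 z1 by (intro measure_pmf.Chebyshev_inequality) auto
  also have "\<dots> = 1 / z\<^sup>2" using s0 by (simp add: power_mult_distrib)
  finally have tail: "measure_pmf.prob M {X. \<bar>z\<bar> * sd M K \<le> \<bar>K X - expect K\<bar>} \<le> 1 / \<sigma>" using z2 by simp
  have le: "1 / \<sigma> \<le> 2022 / \<sigma>" using \<sigma>_pos by (intro divide_right_mono) auto
  show ?thesis
  proof (cases "0 < z")
    case True
    have "1 - ?P = measure_pmf.prob M (- {X. K X \<le> expect K + z * sd M K})"
      using measure_pmf.prob_compl[of "{X. K X \<le> expect K + z * sd M K}" M] by (simp add: Compl_eq_Diff_UNIV)
    also have "\<dots> \<le> measure_pmf.prob M {X. \<bar>z\<bar> * sd M K \<le> \<bar>K X - expect K\<bar>}"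
      using True by (intro measure_pmf.finite_measure_mono) auto
    finally have "1 - ?P \<le> 1 / \<sigma>" using tail by simp
    moreover have "1 - Phi z \<le> 1 / \<sigma>" using Phi_tails(2)[of z] True z1 z2 by simp
    moreover have "?P \<le> 1" by simp
    ultimately show ?thesis using le Phi_bounds[of z] unfolding abs_le_iff by linarith
  next
    case False
    have "?P \<le> measure_pmf.prob M {X. \<bar>z\<bar> * sd M K \<le> \<bar>K X - expect K\<bar>}"
      using False by (intro measure_pmf.finite_measure_mono) auto
    then have "?P \<le> 1 / \<sigma>" using tail by simp
    moreover have "Phi z \<le> 1 / \<sigma>" using Phi_tails(1)[of "- z"] False z1 z2 by simp
    moreover have "0 \<le> ?P" by simp
    ultimately show ?thesis using le Phi_bounds[of z] unfolding abs_le_iff by linarith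
  qed
qed

end

text \<open>For \<sigma> < 100 the right-hand side exceeds 1, so the bound is trivial for two
  probabilities.\<close>

theorem normal_approximation:
  "\<bar>measure_pmf.prob M {X. (K X - expect K) / sd M K \<le> z} - Phi z\<bar> \<le> 2022 / \<sigma>"
proof (cases "100 \<le> \<sigma>")
  case True
  have "{X. (K X - expect K) / sd M K \<le> z} = {X. K X \<le> expect K + z * sd M K}"
    using sd_K_large(2)[OF True] by (auto simp: field_simps)
  then show ?thesis
    using normal_approximation_central[OF True, of z] normal_approximation_tail[OF True, of z]
    by (cases "\<bar>z\<bar> \<le> sqrt \<sigma>") auto
next
  case False
  then have "1 \<le> 2022 / \<sigma>" using \<sigma>_pos by simp
  moreover have "0 \<le> measure_pmf.prob M {X. (K X - expect K) / sd M K \<le> z}"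
    "measure_pmf.prob M {X. (K X - expect K) / sd M K \<le> z} \<le> 1" by auto
  ultimately show ?thesis using Phi_bounds[of z] unfolding abs_le_iff by linarith
qed

end

section \<open>Random cosmological polytopes\<close>

lemma real_choose_2: "real (k choose 2) = real k * (real k - 1) / 2"
proof (induction k)
  case (Suc k)
  have "Suc k choose 2 = k + (k choose 2)" by (simp add: numeral_2_eq_2)
  then show ?case using Suc by (simp add: field_simps)
qed simp

definition non_edge_count :: "nat \<Rightarrow> (nat set \<Rightarrow> bool) \<Rightarrow> real" where
  "non_edge_count n X = (\<Sum>v\<in>{1..n}. let d = card {f \<in> possible_arcs n. X f \<and> v \<in> f} in if 2 \<le> d then real d else 0)"

abbreviation random_edges :: "nat \<Rightarrow> (nat set \<Rightarrow> bool) \<Rightarrow> real" where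
  "random_edges n X \<equiv> polytope_edges ({1..n}, {f \<in> possible_arcs n. X f})"

lemma finite_possible_arcs: "finite (possible_arcs n)"
  unfolding possible_arcs_def by simp

lemma card_possible_arcs: "real (card (possible_arcs n)) = real n * (real n - 1) / 2"
  unfolding possible_arcs_def using n_subsets[of "{1..n}" 2] by (simp add: real_choose_2)

lemma random_edges_eq:
  "random_edges n X = 9 / 2 * (ones (possible_arcs n) X)\<^sup>2 - 3 / 2 * ones (possible_arcs n) X - non_edge_count n X"
proof -
  let ?G = "({1..n}, {f \<in> possible_arcs n. X f})"
  interpret simple_graph ?G
    by unfold_locales (auto simp: finite_simple_graph_def possible_arcs_def)
  have val: "valency v = card {f \<in> possible_arcs n. X f \<and> v \<in> f}" for v
    unfolding valency_def snd_conv by (simp add: conj_assoc)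
  have "non_edge_count n X = real (\<Sum>v\<in>V. if 2 \<le> valency v then valency v else 0)"
    unfolding non_edge_count_def Let_def val of_nat_sum fst_conv by (intro sum.cong) auto
  then have "real (face_number 1 P) + non_edge_count n X = real ((3 * card E) choose 2)"
    unfolding face_number_1_cosmological_polytope[symmetric] by simp
  then show ?thesis
    unfolding polytope_edges_def real_choose_2 ones_def by (simp add: power2_eq_square field_simps)
qed

lemma non_edge_count_nonneg: "0 \<le> non_edge_count n X"
  unfolding non_edge_count_def Let_def by (intro sum_nonneg) auto

text \<open>Handshake argument: dropping the restriction to degrees at least 2 leaves the number of
  incidences, two per arc.\<close>

lemma non_edge_count_le: "non_edge_count n X \<le> 2 * ones (possible_arcs n) X"
proof -
  let ?E = "{f \<in> possible_arcs n. X f}"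
  have fin: "finite ?E" using finite_possible_arcs by simp
  have "non_edge_count n X \<le> (\<Sum>v\<in>{1..n}. real (card {f \<in> ?E. v \<in> f}))"
    unfolding non_edge_count_def Let_def by (intro sum_mono) (auto simp: conj_assoc)
  also have "\<dots> = (\<Sum>v\<in>{1..n}. \<Sum>f\<in>?E. of_bool (v \<in> f))"
    using fin by (simp add: of_bool_def sum.If_cases Int_def)
  also have "\<dots> = (\<Sum>f\<in>?E. \<Sum>v\<in>{1..n}. of_bool (v \<in> f))"
    by (rule sum.swap)
  also have "\<dots> = (\<Sum>f\<in>?E. 2)"
  proof (rule sum.cong)
    fix f assume "f \<in> ?E"
    then have "{v \<in> {1..n}. v \<in> f} = f" "card f = 2" by (auto simp: possible_arcs_def)
    then show "(\<Sum>v\<in>{1..n}. of_bool (v \<in> f)) = (2 :: real)"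
      by (simp add: of_bool_def sum.If_cases Int_def)
  qed simp
  finally show ?thesis by (simp add: ones_def)
qed

text \<open>Adding an arc raises the degrees of its two ends by one, and each contributes an
  increase of at most 2.\<close>

lemma non_edge_count_diff:
  assumes f: "f \<in> possible_arcs n"
  shows "0 \<le> non_edge_count n (X(f := True)) - non_edge_count n (X(f := False))"
    and "non_edge_count n (X(f := True)) - non_edge_count n (X(f := False)) \<le> 4"
proof -
  define b where "b d = (if 2 \<le> d then real d else 0)" for d :: nat
  define inc where "inc Y v = {g \<in> possible_arcs n. Y g \<and> v \<in> g}" for Y :: "nat set \<Rightarrow> bool" and v
  have deg: "card (inc (X(f := True)) v) = card (inc (X(f := False)) v) + of_bool (v \<in> f)" for v
  proof -
    have "inc (X(f := True)) v = (if v \<in> f then insert f (inc (X(f := False)) v) else inc (X(f := False)) v)"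
      using f by (auto simp: inc_def)
    moreover have "f \<notin> inc (X(f := False)) v" "finite (inc (X(f := False)) v)"
      using finite_possible_arcs by (auto simp: inc_def)
    ultimately show ?thesis by simp
  qed
  have eq: "non_edge_count n (X(f := True)) - non_edge_count n (X(f := False))
      = (\<Sum>v\<in>{1..n}. b (card (inc (X(f := True)) v)) - b (card (inc (X(f := False)) v)))"
    unfolding non_edge_count_def Let_def b_def inc_def by (rule sum_subtractf[symmetric])
  \<comment> \<open>The increase 2 occurs when the degree passes from 1 to 2; from 0 to 1 it is 0,
    and later it is 1.\<close>
  have bd: "0 \<le> b (d + of_bool c) - b d" "b (d + of_bool c) - b d \<le> 2 * of_bool c" for d c
    by (auto simp: b_def)
  show "0 \<le> non_edge_count n (X(f := True)) - non_edge_count n (X(f := False))"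
    unfolding eq deg by (intro sum_nonneg bd)
  have "non_edge_count n (X(f := True)) - non_edge_count n (X(f := False)) \<le> (\<Sum>v\<in>{1..n}. 2 * of_bool (v \<in> f))"
    unfolding eq deg by (intro sum_mono bd)
  also have "\<dots> = 2 * real (card {v \<in> {1..n}. v \<in> f})"
    by (simp add: of_bool_def sum.If_cases Int_def flip: sum_distrib_left)
  also have "{v \<in> {1..n}. v \<in> f} = f" using f by (auto simp: possible_arcs_def)
  also have "2 * real (card f) = 4" using f by (simp add: possible_arcs_def)
  finally show "non_edge_count n (X(f := True)) - non_edge_count n (X(f := False)) \<le> 4" .
qed

lemma quadratic_functional_random_edges:
  assumes n: "2 \<le> n" and p: "0 < p" "p < 1"
  shows "quadratic_functional (possible_arcs n) p (non_edge_count n) (random_edges n)"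
proof
  have "{1, 2} \<in> possible_arcs n" using n by (auto simp: possible_arcs_def)
  then show "possible_arcs n \<noteq> {}" by blast
qed (rule finite_possible_arcs p non_edge_count_nonneg non_edge_count_le random_edges_eq
    | erule non_edge_count_diff)+

lemma mean_edges_eq: "mean_edges n p = measure_pmf.expectation (bits (possible_arcs n) p) (random_edges n)"
  by (simp add: mean_edges_def erdos_renyi_def)

lemma variance_edges_eq: "variance_edges n p = measure_pmf.variance (bits (possible_arcs n) p) (random_edges n)"
  unfolding variance_edges_def by (simp add: erdos_renyi_def)

lemma cdf_standardized_edges_law:
  "cdf (standardized_edges_law n p) z = measure_pmf.prob (bits (possible_arcs n) p)
    {X. (random_edges n X - mean_edges n p) / sqrt (variance_edges n p) \<le> z}"
proof -
  have "cdf (standardized_edges_law n p) z = measure_pmf.prob (erdos_renyi n p)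
      {G. (polytope_edges G - mean_edges n p) / sqrt (variance_edges n p) \<le> z}"
    unfolding cdf_def standardized_edges_law_def by (subst measure_distr) (auto simp: vimage_def)
  also have "\<dots> = measure_pmf.prob (bits (possible_arcs n) p)
    {X. (random_edges n X - mean_edges n p) / sqrt (variance_edges n p) \<le> z}"
    unfolding erdos_renyi_def measure_map_pmf by (simp add: vimage_def)
  finally show ?thesis .
qed

lemma asymp_simeqI:
  assumes c: "0 < c" and ev: "eventually (\<lambda>n. c \<le> a n / b n \<and> a n / b n \<le> C) sequentially"
  shows "asymp_simeq a b"
proof -
  have lo: "ereal c \<le> liminf (\<lambda>n. ereal \<bar>a n / b n\<bar>)"
    using ev by (intro Liminf_bounded) (auto elim!: eventually_mono simp del: abs_divide)
  have hi: "limsup (\<lambda>n. ereal \<bar>a n / b n\<bar>) \<le> ereal C"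
    using ev c by (intro Limsup_bounded) (auto elim!: eventually_mono simp del: abs_divide)
  have "0 < ereal c" using c by simp
  then have "0 < liminf (\<lambda>n. ereal \<bar>a n / b n\<bar>)" using lo by (rule less_le_trans)
  moreover have "limsup (\<lambda>n. ereal \<bar>a n / b n\<bar>) < \<infinity>" using hi by (rule le_less_trans) simp
  ultimately show ?thesis
    unfolding asymp_simeq_def by (simp add: Liminf_le_Limsup)
qed

lemma kolmogorov_dist_bounds:
  assumes "\<And>z. \<bar>cdf M z - cdf N z\<bar> \<le> c"
  shows "0 \<le> kolmogorov_dist M N" "kolmogorov_dist M N \<le> c"
proof -
  have bdd: "bdd_above (range (\<lambda>z. \<bar>cdf M z - cdf N z\<bar>))" using assms by (intro bdd_aboveI2)
  have "0 \<le> \<bar>cdf M 0 - cdf N 0\<bar>" by simp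
  also have "\<dots> \<le> kolmogorov_dist M N" unfolding kolmogorov_dist_def by (rule cSUP_upper[OF _ bdd]) simp
  finally show "0 \<le> kolmogorov_dist M N" .
  show "kolmogorov_dist M N \<le> c" unfolding kolmogorov_dist_def by (rule cSUP_least) (use assms in auto)
qed

section \<open>Explicit bounds for fixed n and p\<close>

context
  fixes n :: nat and p :: real
  assumes n: "2 \<le> n" and p: "0 < p" "p < 1"
begin

interpretation quadratic_functional "possible_arcs n" p "non_edge_count n" "random_edges n"
  by (rule quadratic_functional_random_edges[OF n p])

lemma card_arcs_bounds:
  "real n ^ 2 / 4 \<le> real (card (possible_arcs n))" "real (card (possible_arcs n)) \<le> real n ^ 2 / 2"
proof -
  have "real n * 2 \<le> real n * real n" using n by (intro mult_left_mono) auto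
  then show "real n ^ 2 / 4 \<le> real (card (possible_arcs n))"
    "real (card (possible_arcs n)) \<le> real n ^ 2 / 2"
    unfolding card_possible_arcs power2_eq_square by (simp_all add: field_simps)
qed

text \<open>For \<mu> \<ge> 36 the linear terms of \<open>expect_K_bounds\<close> are at most
  \<mu>^2 / 2, so the mean lies between 4 \<mu>^2 and 5 \<mu>^2. With \<mu> between n^2 p / 4 and
  n^2 p / 2 the constants become 4/16 and 5/4.\<close>

lemma mean_edges_bounds:
  assumes "36 \<le> real (card (possible_arcs n)) * p"
  shows "1 / 4 \<le> mean_edges n p / (real n ^ 4 * p ^ 2)" "mean_edges n p / (real n ^ 4 * p ^ 2) \<le> 5 / 4"
proof -
  have \<mu>: "36 \<le> \<mu>" using assms by (simp add: \<mu>_def)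
  then have \<mu>2: "36 * \<mu> \<le> \<mu>\<^sup>2" unfolding power2_eq_square by (intro mult_right_mono) auto
  have "4 * \<mu>\<^sup>2 \<le> mean_edges n p" "mean_edges n p \<le> 5 * \<mu>\<^sup>2"
    unfolding mean_edges_eq using expect_K_bounds \<mu>2 \<mu> by argo+
  moreover have "real n ^ 2 / 4 * p \<le> \<mu>" "\<mu> \<le> real n ^ 2 / 2 * p"
    unfolding \<mu>_def using card_arcs_bounds p by (intro mult_right_mono, auto)+
  then have "(real n ^ 2 / 4 * p)\<^sup>2 \<le> \<mu>\<^sup>2" "\<mu>\<^sup>2 \<le> (real n ^ 2 / 2 * p)\<^sup>2"
    using p \<mu> by (intro power_mono, auto)+
  moreover have "(real n ^ 2 / 4 * p)\<^sup>2 = real n ^ 4 * p ^ 2 / 16" "(real n ^ 2 / 2 * p)\<^sup>2 = real n ^ 4 * p ^ 2 / 4"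
    by (simp_all add: power_mult_distrib power_divide flip: power_mult)
  ultimately have "1 / 4 * (real n ^ 4 * p ^ 2) \<le> mean_edges n p" "mean_edges n p \<le> 5 / 4 * (real n ^ 4 * p ^ 2)"
    by argo+
  moreover have "0 < real n ^ 4 * p ^ 2" using n p by simp
  ultimately show "1 / 4 \<le> mean_edges n p / (real n ^ 4 * p ^ 2)" "mean_edges n p / (real n ^ 4 * p ^ 2) \<le> 5 / 4"
    by (simp_all only: pos_le_divide_eq[where c = "real n ^ 4 * p ^ 2"] pos_divide_le_eq[where c = "real n ^ 4 * p ^ 2"])
qed

text \<open>For \<mu> \<ge> 36 the error 22 \<sigma> sqrt \<mu> is less than 4 \<mu> \<sigma>, so
  the standard deviation lies between 5 \<mu> \<sigma> and 13 \<mu> \<sigma>. Cubing the bounds on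
  the number of possible arcs gives 5^2/4^3 and 13^2/2^3.\<close>

lemma variance_edges_bounds:
  assumes "36 \<le> real (card (possible_arcs n)) * p"
  shows "25 / 64 \<le> variance_edges n p / (real n ^ 6 * p ^ 3 * (1 - p))"
    "variance_edges n p / (real n ^ 6 * p ^ 3 * (1 - p)) \<le> 169 / 8"
proof -
  define N where "N = real (card (possible_arcs n))"
  have \<mu>: "36 \<le> \<mu>" using assms by (simp add: \<mu>_def)
  have "6 \<le> sqrt \<mu>" using \<mu> by (intro real_le_rsqrt) auto
  then have "6 * sqrt \<mu> \<le> sqrt \<mu> * sqrt \<mu>" using \<mu> by (intro mult_right_mono) auto
  then have "6 * sqrt \<mu> \<le> \<mu>" using \<mu> by simp
  then have "\<sigma> * (6 * sqrt \<mu>) \<le> \<sigma> * \<mu>" using \<sigma>_pos by (intro mult_left_mono) auto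
  moreover have "0 \<le> \<sigma> * sqrt \<mu>" using \<sigma>_pos \<mu> by simp
  moreover have "\<bar>sd M (random_edges n) - 9 * \<mu> * \<sigma>\<bar> \<le> 22 * \<sigma> * sqrt \<mu>" using \<mu> by (intro sd_K) auto
  ultimately have s: "5 * (\<mu> * \<sigma>) \<le> sd M (random_edges n)" "sd M (random_edges n) \<le> 13 * (\<mu> * \<sigma>)"
    unfolding abs_le_iff by argo+
  have v: "variance_edges n p = (sd M (random_edges n))\<^sup>2"
    unfolding variance_edges_eq by (rule real_sqrt_pow2[symmetric]) (rule measure_pmf.variance_positive)
  have ms: "0 \<le> \<mu> * \<sigma>" using \<mu>_pos \<sigma>_pos by simp
  have "(5 * (\<mu> * \<sigma>))\<^sup>2 \<le> variance_edges n p"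
    unfolding v by (rule power_mono[OF s(1)]) (use ms in linarith)
  moreover have "variance_edges n p \<le> (13 * (\<mu> * \<sigma>))\<^sup>2"
    unfolding v by (rule power_mono[OF s(2)]) (use ms s(1) in linarith)
  moreover have "(\<mu> * \<sigma>)\<^sup>2 = N ^ 3 * (p ^ 3 * (1 - p))"
    unfolding power_mult_distrib \<sigma>2 by (simp add: \<mu>_def N_def power2_eq_square power3_eq_cube algebra_simps)
  ultimately have v': "25 * (N ^ 3 * (p ^ 3 * (1 - p))) \<le> variance_edges n p"
      "variance_edges n p \<le> 169 * (N ^ 3 * (p ^ 3 * (1 - p)))"
    by (simp_all add: power_mult_distrib)
  have pp: "0 \<le> p ^ 3 * (1 - p)" using p by simp
  have "(real n ^ 2 / 4) ^ 3 \<le> N ^ 3" "N ^ 3 \<le> (real n ^ 2 / 2) ^ 3"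
    unfolding N_def using card_arcs_bounds by (intro power_mono, auto)+
  moreover have "(real n ^ 2 / 4) ^ 3 = real n ^ 6 / 64" "(real n ^ 2 / 2) ^ 3 = real n ^ 6 / 8"
    by (simp_all add: power_divide flip: power_mult)
  ultimately have "real n ^ 6 / 64 * (p ^ 3 * (1 - p)) \<le> N ^ 3 * (p ^ 3 * (1 - p))"
    "N ^ 3 * (p ^ 3 * (1 - p)) \<le> real n ^ 6 / 8 * (p ^ 3 * (1 - p))"
    using mult_right_mono[OF _ pp] by metis+
  then have "25 / 64 * (real n ^ 6 * p ^ 3 * (1 - p)) \<le> variance_edges n p"
    "variance_edges n p \<le> 169 / 8 * (real n ^ 6 * p ^ 3 * (1 - p))"
    using v' unfolding mult.assoc by auto
  moreover have "0 < real n ^ 6 * p ^ 3 * (1 - p)" using n p by simp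
  ultimately show "25 / 64 \<le> variance_edges n p / (real n ^ 6 * p ^ 3 * (1 - p))"
    "variance_edges n p / (real n ^ 6 * p ^ 3 * (1 - p)) \<le> 169 / 8"
    by (simp_all only: pos_le_divide_eq[where c = "real n ^ 6 * p ^ 3 * (1 - p)"]
        pos_divide_le_eq[where c = "real n ^ 6 * p ^ 3 * (1 - p)"])
qed

text \<open>There are at least n^2 / 4 possible arcs, so \<sigma> is at least half of n sqrt(p (1 -
  p)), which doubles 2022.\<close>

lemma kolmogorov_dist_edges_le:
  "\<bar>kolmogorov_dist (standardized_edges_law n p) std_normal_distribution / (1 / (real n * sqrt (p * (1 - p))))\<bar> \<le> 4044"
proof -
  let ?d = "kolmogorov_dist (standardized_edges_law n p) std_normal_distribution"
  let ?r = "real n * sqrt (p * (1 - p))"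
  have r: "0 < ?r" using n p by simp
  have "(?r / 2)\<^sup>2 = real n ^ 2 / 4 * (p * (1 - p))"
    using p by (simp add: power_mult_distrib power_divide)
  also have "\<dots> \<le> real (card (possible_arcs n)) * (p * (1 - p))"
    using card_arcs_bounds p by (intro mult_right_mono) auto
  also have "\<dots> = \<sigma>\<^sup>2" unfolding \<sigma>2 by simp
  finally have "?r / 2 \<le> \<sigma>" by (rule power2_le_imp_le) (use \<sigma>_pos in simp)
  then have "2022 / \<sigma> \<le> 2022 / (?r / 2)" using r \<sigma>_pos by (intro divide_left_mono) auto
  moreover have "\<bar>cdf (standardized_edges_law n p) z - Phi z\<bar> \<le> 2022 / \<sigma>" for z
    unfolding cdf_standardized_edges_law mean_edges_eq variance_edges_eq by (rule normal_approximation)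
  then have d: "0 \<le> ?d" "?d \<le> 2022 / \<sigma>" by (rule kolmogorov_dist_bounds)+
  ultimately have "?d \<le> 2022 / (?r / 2)" by linarith
  then have "?d * ?r \<le> 4044" using r by (simp add: pos_le_divide_eq mult.assoc)
  moreover have "0 \<le> ?d * ?r" by (rule mult_nonneg_nonneg) (use d(1) r in auto)
  ultimately show ?thesis by (simp only: div_by_1 divide_divide_eq_right mult_1_right abs_of_nonneg)
qed

end

theorem theorem3p1:
  fixes p :: "nat \<Rightarrow> real"
  assumes "\<And>n. n \<ge> 1 \<Longrightarrow> 0 < p n \<and> p n < 1"
    and "asymp_gg p (\<lambda>n. 1 / real n ^ 2)"
  shows "asymp_simeq (\<lambda>n. mean_edges n (p n)) (\<lambda>n. real n ^ 4 * p n ^ 2)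
    \<and> asymp_simeq (\<lambda>n. variance_edges n (p n)) (\<lambda>n. real n ^ 6 * p n ^ 3 * (1 - p n))
    \<and> asymp_lesssim
        (\<lambda>n. kolmogorov_dist (standardized_edges_law n (p n)) std_normal_distribution)
        (\<lambda>n. 1 / (real n * sqrt (p n * (1 - p n))))"
proof (intro conjI)
  have p: "0 < p n" "p n < 1" if "2 \<le> n" for n using assms(1)[of n] that by auto
  \<comment> \<open>144 = 4 * 36: with at least n^2 / 4 possible arcs this makes their expected
    number present at least 36.\<close>
  have "eventually (\<lambda>n. 144 \<le> \<bar>p n / (1 / real n ^ 2)\<bar>) sequentially"
    using assms(2) unfolding asymp_gg_def filterlim_at_top by blast
  then have large: "eventually (\<lambda>n. 2 \<le> n \<and> 36 \<le> real (card (possible_arcs n)) * p n) sequentially"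
    using eventually_ge_at_top[of 2]
  proof eventually_elim
    case (elim n)
    then have "144 \<le> p n * real n ^ 2" using p[of n] by simp
    then have "36 \<le> real n ^ 2 / 4 * p n" by (simp add: mult.commute)
    also have "\<dots> \<le> real (card (possible_arcs n)) * p n"
      using p[OF elim(2)] card_arcs_bounds(1)[OF elim(2) p[OF elim(2)]] by (intro mult_right_mono) auto
    finally show ?case using elim by simp
  qed
  have "eventually (\<lambda>n. 1 / 4 \<le> mean_edges n (p n) / (real n ^ 4 * p n ^ 2)
      \<and> mean_edges n (p n) / (real n ^ 4 * p n ^ 2) \<le> 5 / 4) sequentially"
    using large by (rule eventually_mono) (intro conjI mean_edges_bounds p, auto)
  then show "asymp_simeq (\<lambda>n. mean_edges n (p n)) (\<lambda>n. real n ^ 4 * p n ^ 2)"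
    by (rule asymp_simeqI[rotated]) simp
  have "eventually (\<lambda>n. 25 / 64 \<le> variance_edges n (p n) / (real n ^ 6 * p n ^ 3 * (1 - p n))
      \<and> variance_edges n (p n) / (real n ^ 6 * p n ^ 3 * (1 - p n)) \<le> 169 / 8) sequentially"
    using large by (rule eventually_mono) (intro conjI variance_edges_bounds p, auto)
  then show "asymp_simeq (\<lambda>n. variance_edges n (p n)) (\<lambda>n. real n ^ 6 * p n ^ 3 * (1 - p n))"
    by (rule asymp_simeqI[rotated]) simp
  have "limsup (\<lambda>n. ereal \<bar>kolmogorov_dist (standardized_edges_law n (p n)) std_normal_distribution
      / (1 / (real n * sqrt (p n * (1 - p n))))\<bar>) \<le> ereal 4044"
    using large by (intro Limsup_bounded, elim eventually_mono)
      (simp only: ereal_less_eq, intro kolmogorov_dist_edges_le p, auto)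
  then show "asymp_lesssim
      (\<lambda>n. kolmogorov_dist (standardized_edges_law n (p n)) std_normal_distribution)
      (\<lambda>n. 1 / (real n * sqrt (p n * (1 - p n))))"
    unfolding asymp_lesssim_def by (rule le_less_trans) simp
qed

end
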